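(* Let $U$ be an open, bounded set in $\mathbb{R}^N$, let $\mu\in\mathcal{M}(U;\mathbb{R}^d)$ be a Radon measure, and let $g:\mathbb{R}^d\to[0,\infty)$ be a convex function such that $$0\le g(p)\le C(1+|p|)\quad\text{for all }p\in\mathbb{R}^d\text{ and some }C>0,$$ and $$\Big|\frac{g(tp)}{t}-g^\infty(p)\Big|\le\frac{C}{t^\alpha}$$ for some $\alpha>1$ and $C>0$, for all $p\in\mathbb{R}^d$ with $|p|=1$ and every $t>0$. Then, for every $\Omega\subset\subset U$ with $|\partial\Omega|=|\mu|(\partial\Omega)=0$, $$\lim_{\varepsilon\to0^+}\int_\Omega g(\mu_\varepsilon)\,dx=\int_\Omega g(\mu_{ac})\,dx+\int_\Omega g^\infty(\nu)\,d|\mu_s|,$$ where $\mu_\varepsilon:=\mu*\phi_\varepsilon$ for $\varepsilon>0$.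
   Context: $\mathcal{M}(U;\mathbb{R}^d)$ denotes the finite $\mathbb{R}^d$-valued Radon measures on $U$. $|E|$ denotes the Lebesgue measure of $E$ and $|\mu|$ the total variation measure of $\mu$. The Radon–Nikodym decomposition is $\mu=\mu_{ac}\mathcal{L}^N\llcorner U+\mu_s$ with $\mu_{ac}\in L^1(U;\mathbb{R}^d)$ and $|\mu_s|\perp\mathcal{L}^N$, and $\nu=\frac{d\mu_s}{d|\mu_s|}$ is the polar density, with $|\nu|=1$ $|\mu_s|$-a.e. The recession function is $g^\infty(p):=\limsup_{t\to+\infty}g(tp)/t$. Here $\phi\in C^\infty(\mathbb{R}^N;[0,\infty))$ is a fixed function with $\operatorname{supp}\phi\subset B(0,1)$ and $\int_{\mathbb{R}^N}\phi\,dx=1$, $\phi_\varepsilon(x):=\varepsilon^{-N}\phi(x/\varepsilon)$, and $\mu*\phi_\varepsilon(x)=\int\phi_\varepsilon(x-y)\,d\mu(y)$, defined on $\Omega$ for $\varepsilon$ small. *)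

theory Defs
  imports "HOL-Analysis.Analysis"
begin

section \<open>Vector-valued measures on the Borel subsets of a set\<close>

text \<open>An \<open>'b\<close>-valued measure on \<open>U\<close> is represented by its set function. Only its values on the
  Borel subsets of \<open>U\<close>, i.e. on \<^term>\<open>sets (restrict_space borel U)\<close>, matter.\<close>

definition variation :: "'a::euclidean_space set \<Rightarrow> ('a set \<Rightarrow> 'b::euclidean_space) \<Rightarrow> 'a set \<Rightarrow> ennreal"
  where "variation U \<mu> E =
    (SUP A\<in>{A :: nat \<Rightarrow> 'a set. range A \<subseteq> sets (restrict_space borel U) \<and> disjoint_family A
               \<and> (\<Union>i. A i) = E}. \<Sum>i. ennreal (norm (\<mu> (A i))))"

definition total_variation :: "'a::euclidean_space set \<Rightarrow> ('a set \<Rightarrow> 'b::euclidean_space) \<Rightarrow> 'a measure"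
  where "total_variation U \<mu> = measure_of U (sets (restrict_space borel U)) (variation U \<mu>)"

text \<open>Finite Borel measures on an open subset of a Euclidean space are automatically regular, so
  countable additivity and finite variation describe the finite vector-valued Radon measures.\<close>

definition finite_radon_measure :: "'a::euclidean_space set \<Rightarrow> ('a set \<Rightarrow> 'b::euclidean_space) \<Rightarrow> bool"
  where "finite_radon_measure U \<mu> \<longleftrightarrow>
    \<mu> {} = 0 \<and>
    (\<forall>A :: nat \<Rightarrow> 'a set. range A \<subseteq> sets (restrict_space borel U) \<and> disjoint_family A
       \<longrightarrow> (\<lambda>i. \<mu> (A i)) sums \<mu> (\<Union>i. A i)) \<and>
    variation U \<mu> U < \<infinity>"

text \<open>A Radon--Nikodym derivative of a vector-valued set function with respect to a positive
  measure, chosen up to null sets as in \<^const>\<open>RN_deriv\<close>.\<close>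

definition vec_RN_deriv :: "'a measure \<Rightarrow> ('a set \<Rightarrow> 'b::euclidean_space) \<Rightarrow> 'a \<Rightarrow> 'b"
  where "vec_RN_deriv M \<mu> =
    (SOME h. integrable M h \<and> (\<forall>E\<in>sets M. \<mu> E = (LINT x:E|M. h x)))"

definition polar_density :: "'a::euclidean_space set \<Rightarrow> ('a set \<Rightarrow> 'b::euclidean_space) \<Rightarrow> 'a \<Rightarrow> 'b"
  where "polar_density U \<mu> = vec_RN_deriv (total_variation U \<mu>) \<mu>"

text \<open>The integral of a scalar function against a vector measure, \<open>d\<mu> = (d\<mu>/d|\<mu>|) d|\<mu>|\<close>.\<close>

definition vec_integral ::
    "'a::euclidean_space set \<Rightarrow> ('a set \<Rightarrow> 'b::euclidean_space) \<Rightarrow> ('a \<Rightarrow> real) \<Rightarrow> 'b"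
  where "vec_integral U \<mu> f = (LINT y|total_variation U \<mu>. f y *\<^sub>R polar_density U \<mu> y)"


section \<open>Decomposition with respect to Lebesgue measure\<close>

definition minus_density :: "('a::euclidean_space set \<Rightarrow> 'b::euclidean_space) \<Rightarrow> ('a \<Rightarrow> 'b) \<Rightarrow> 'a set \<Rightarrow> 'b"
  where "minus_density \<mu> f E = \<mu> E - (LINT x:E|lborel. f x)"

definition lebesgue_singular :: "'a::euclidean_space set \<Rightarrow> 'a measure \<Rightarrow> bool"
  where "lebesgue_singular U M \<longleftrightarrow>
    (\<exists>S\<in>sets (restrict_space borel U). emeasure lborel S = 0 \<and> emeasure M (U - S) = 0)"

text \<open>\<open>\<mu> = ac_part U \<mu> \<cdot> lborel + sing_part U \<mu>\<close>; the density is determined up to null sets.\<close>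

definition ac_part :: "'a::euclidean_space set \<Rightarrow> ('a set \<Rightarrow> 'b::euclidean_space) \<Rightarrow> 'a \<Rightarrow> 'b"
  where "ac_part U \<mu> =
    (SOME f. set_integrable lborel U f \<and>
             finite_radon_measure U (minus_density \<mu> f) \<and>
             lebesgue_singular U (total_variation U (minus_density \<mu> f)))"

definition sing_part :: "'a::euclidean_space set \<Rightarrow> ('a set \<Rightarrow> 'b::euclidean_space) \<Rightarrow> 'a set \<Rightarrow> 'b"
  where "sing_part U \<mu> = minus_density \<mu> (ac_part U \<mu>)"


section \<open>Recession function and mollification\<close>

text \<open>The upper limit is taken in the extended reals; it is finite for \<open>g\<close> of linear growth.\<close>

definition recession :: "('b::euclidean_space \<Rightarrow> real) \<Rightarrow> 'b \<Rightarrow> real"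
  where "recession g p = real_of_ereal (Limsup at_top (\<lambda>t::real. ereal (g (t *\<^sub>R p) / t)))"

fun C_k :: "nat \<Rightarrow> ('a::euclidean_space \<Rightarrow> real) \<Rightarrow> bool"
  where
    "C_k 0 f \<longleftrightarrow> continuous_on UNIV f"
  | "C_k (Suc k) f \<longleftrightarrow> (\<forall>x. f differentiable (at x)) \<and>
       (\<forall>b\<in>Basis. C_k k (\<lambda>x. frechet_derivative f (at x) b))"

definition mollifier_kernel :: "('a::euclidean_space \<Rightarrow> real) \<Rightarrow> bool"
  where "mollifier_kernel \<phi> \<longleftrightarrow>
    (\<forall>k. C_k k \<phi>) \<and> (\<forall>x. 0 \<le> \<phi> x) \<and> closure {x. \<phi> x \<noteq> 0} \<subseteq> ball 0 1 \<and>
    (LINT x|lborel. \<phi> x) = 1"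

definition rescale :: "('a::euclidean_space \<Rightarrow> real) \<Rightarrow> real \<Rightarrow> 'a \<Rightarrow> real"
  where "rescale \<phi> \<epsilon> x = \<phi> (x /\<^sub>R \<epsilon>) / \<epsilon> ^ DIM('a)"

text \<open>The integral runs over \<open>U\<close>, so this is defined for all \<open>x\<close>: points whose \<open>\<epsilon>\<close>-ball leaves \<open>U\<close>
  see the extension of \<open>\<mu>\<close> by zero.\<close>

definition mollify ::
    "'a::euclidean_space set \<Rightarrow> ('a set \<Rightarrow> 'b::euclidean_space) \<Rightarrow> ('a \<Rightarrow> real) \<Rightarrow> real \<Rightarrow> 'a \<Rightarrow> 'b"
  where "mollify U \<mu> \<phi> \<epsilon> x = vec_integral U \<mu> (\<lambda>y. rescale \<phi> \<epsilon> (x - y))"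

end

theory Submission
  imports Defs
begin

text \<open>
  Following Reshetnyak, the pair \<open>(\<mu>, \<L>)\<close> of \<open>\<mu>\<close> and Lebesgue measure is written as \<open>w \<lambda>\<close> with
  \<open>\<lambda> = \<L> + |\<mu>\<^sub>s|\<close>, and \<open>g\<close> is replaced by its perspective \<open>G (p, s) = |s| g (p / |s|)\<close>,
  \<open>G (p, 0) = g\<^sup>\<infinity> p\<close>, which is positively homogeneous of degree one. Inside \<open>\<Omega>\<close> the mollified pair
  is \<open>(\<mu>\<^sub>\<epsilon>, 1)\<close>, so \<open>g (\<mu>\<^sub>\<epsilon>) = G (w\<lambda> * \<phi>\<^sub>\<epsilon>)\<close>, and the right-hand side of the claim is
  \<open>\<integral>\<^sub>\<Omega> G (w) d\<lambda>\<close>. The rate hypothesis keeps \<open>g - g\<^sup>\<infinity>\<close> bounded, which makes \<open>G\<close> globally Lipschitz,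
  up to the boundary \<open>s = 0\<close>. Hence the commutator \<open>G (w\<lambda> * \<phi>\<^sub>\<epsilon>) - (G (w) \<lambda>) * \<phi>\<^sub>\<epsilon>\<close> is controlled in \<open>L\<^sup>1\<close>
  by the oscillation of a uniformly continuous \<open>L\<^sup>1(\<lambda>)\<close> approximation of \<open>w\<close>, and the limit
  \<open>\<integral>\<^sub>\<Omega> (G (w) \<lambda>) * \<phi>\<^sub>\<epsilon> dx \<rightarrow> \<integral>\<^sub>\<Omega> G (w) d\<lambda>\<close> follows from \<open>\<lambda> (\<partial>\<Omega>) = 0\<close>.
\<close>

section \<open>Vector-valued Radon--Nikodym theorem\<close>

text \<open>The kernel at scale \<open>\<epsilon>\<close>, integrated against
  \<open>\<lambda>\<close>, need not have mass 1. Homogeneity of degree one absorbs this: for a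
  constant \<open>c\<close> and a weight \<open>k \<ge> 0\<close>, \<open>G (\<integral> k c
  d\<lambda>) = \<integral> k G c d\<lambda>\<close> whatever the mass of \<open>k\<close>. A
  Lipschitz bound on all of the product space, and not mere continuity, is sought because it turns
  an \<open>L1\<close> error in \<open>w\<close> into an \<open>L1\<close> error of the energies,
  also where the singular part sends the ratio p / s to infinity. Three features of the formal
  setting shape the rest. \<open>polar_density\<close> and \<open>ac_part\<close> are choices by
  \<open>SOME\<close>, so Radon-Nikodym and Lebesgue decomposition must be established before
  anything can be said about them. The measure \<open>\<mu>\<close> lives on the Borel subsets of
  \<open>U\<close>, whereas convolution is done on the whole space, so \<open>\<lambda>\<close> is
  carried over by the inclusion. Finally \<open>\<Omega>\<close> may fail to be Borel: it lies
  between its interior and the union of its interior and frontier, which is why the integrals are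
  taken in completed measures.\<close>

lemma finite_measure_real_density:
  assumes "finite_measure M" "finite_measure N" "absolutely_continuous M N" "sets N = sets M"
  obtains D :: "'a \<Rightarrow> real" where "D \<in> borel_measurable M" "\<And>x. 0 \<le> D x"
    "density M (\<lambda>x. ennreal (D x)) = N"
proof -
  interpret finite_measure M by fact
  obtain D where D: "D \<in> borel_measurable M" "AE x in M. RN_deriv M N x = ennreal (D x)"
      "\<And>x. 0 \<le> D x"
    using real_RN_deriv[OF assms(2-4)] by metis
  moreover have "density M (\<lambda>x. ennreal (D x)) = N"
    using density_RN_deriv[OF assms(3,4)] D density_cong[OF _ _ D(2)] by auto
  ultimately show thesis using that by blast
qed

text \<open>Domination by \<open>M\<close> takes the place of a Hahn decomposition: it makes
  \<open>M + m\<close> a nonnegative finite measure, absolutely continuous with respect to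
  \<open>M\<close>. Subtracting 1 from its density leaves a density of \<open>m\<close>.\<close>

lemma signed_Radon_Nikodym:
  fixes m :: "'a set \<Rightarrow> real"
  assumes "finite_measure M"
    and add: "\<And>A :: nat \<Rightarrow> 'a set. range A \<subseteq> sets M \<Longrightarrow> disjoint_family A
               \<Longrightarrow> (\<lambda>i. m (A i)) sums m (\<Union>i. A i)"
    and bound: "\<And>E. E \<in> sets M \<Longrightarrow> \<bar>m E\<bar> \<le> measure M E"
  shows "\<exists>h. integrable M h \<and> (\<forall>E\<in>sets M. m E = (LINT x:E|M. h x))"
proof -
  interpret finite_measure M by fact
  define N where "N = measure_of (space M) (sets M) (\<lambda>E. ennreal (measure M E + m E))"
  have [simp]: "space N = space M" and sN [simp, measurable_cong]: "sets N = sets M"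
    by (auto simp: N_def)
  have eN: "emeasure N E = ennreal (measure M E + m E)" if "E \<in> sets M" for E
  proof (rule emeasure_measure_of[OF N_def])
    have "m {} = 0" using bound[of "{}"] by simp
    then show "positive (sets N) (\<lambda>E. ennreal (measure M E + m E))"
      by (simp add: positive_def)
    show "countably_additive (sets N) (\<lambda>E. ennreal (measure M E + m E))"
    proof (rule countably_additiveI)
      fix A :: "nat \<Rightarrow> 'a set" assume A: "range A \<subseteq> sets N" "disjoint_family A"
      have "(\<lambda>i. measure M (A i) + m (A i)) sums (measure M (\<Union>i. A i) + m (\<Union>i. A i))"
        using A by (intro sums_add add finite_measure_UNION) auto
      moreover have "0 \<le> measure M (A i) + m (A i)" for i
        using A bound[of "A i"] by (auto simp: abs_le_iff image_subset_iff)
      ultimately show "(\<Sum>i. ennreal (measure M (A i) + m (A i)))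
           = ennreal (measure M (\<Union>i. A i) + m (\<Union>i. A i))"
        by (subst suminf_ennreal2) (auto simp: sums_iff)
    qed
  qed (use that sets.space_closed in auto)
  have fN: "finite_measure N" by (rule finite_measureI) (simp add: eN)
  have ac: "absolutely_continuous M N"
    unfolding absolutely_continuous_def
  proof
    fix A assume A: "A \<in> null_sets M"
    then have "measure M A = 0" "A \<in> sets M" by (auto simp: measure_def)
    then show "A \<in> null_sets N" using bound[of A] by (auto simp: null_sets_def eN)
  qed
  obtain D :: "'a \<Rightarrow> real" where D: "D \<in> borel_measurable M" "\<And>x. 0 \<le> D x"
    and dens: "density M (\<lambda>x. ennreal (D x)) = N"
    using finite_measure_real_density[OF assms(1) fN ac sN] by metis
  have "integrable N (\<lambda>x. 1::real)" by (simp add: finite_measure.integrable_const[OF fN])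
  then have iD: "integrable M D"
    unfolding dens[symmetric] using D by (subst (asm) integrable_real_density) auto
  have "m E = (LINT x:E|M. D x - 1)" if E: "E \<in> sets M" for E
  proof -
    have "measure M E + m E = measure N E"
      using eN[OF E] bound[OF E] by (simp add: measure_def)
    also have "\<dots> = (LINT x|N. indicator E x)" using E by simp
    also have "\<dots> = (LINT x:E|M. D x)"
      unfolding dens[symmetric] using D E
      by (subst integral_real_density) (auto simp: set_lebesgue_integral_def mult.commute)
    moreover have "(LINT x:E|M. 1::real) = measure M E"
      using E by (simp add: set_lebesgue_integral_def)
    moreover have "set_integrable M E D" "set_integrable M E (\<lambda>x. 1::real)"
      using integrable_mult_indicator[OF E iD] integrable_mult_indicator[OF E integrable_const[of "1::real"]]
      by (auto simp: set_integrable_def)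
    ultimately show ?thesis by (simp add: set_integral_diff)
  qed
  moreover have "integrable M (\<lambda>x. D x - 1)" using iD by simp
  ultimately show ?thesis by blast
qed

text \<open>Reduction to coordinates: each \<open>m E \<bullet> b\<close> inherits the domination
  because basis vectors have norm one, and the scalar densities are reassembled along
  \<open>Basis\<close>.\<close>

lemma vector_Radon_Nikodym:
  fixes m :: "'a set \<Rightarrow> 'b::euclidean_space"
  assumes "finite_measure M"
    and add: "\<And>A :: nat \<Rightarrow> 'a set. range A \<subseteq> sets M \<Longrightarrow> disjoint_family A
               \<Longrightarrow> (\<lambda>i. m (A i)) sums m (\<Union>i. A i)"
    and bound: "\<And>E. E \<in> sets M \<Longrightarrow> norm (m E) \<le> measure M E"
  shows "\<exists>h. integrable M h \<and> (\<forall>E\<in>sets M. m E = (LINT x:E|M. h x))"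
proof -
  have "\<exists>h. integrable M h \<and> (\<forall>E\<in>sets M. m E \<bullet> b = (LINT x:E|M. h x))" if b: "b \<in> Basis" for b
    by (rule signed_Radon_Nikodym[OF assms(1)])
       (use b in \<open>auto intro!: bounded_linear.sums[OF bounded_linear_inner_left] add
           order_trans[OF Basis_le_norm bound]\<close>)
  then obtain h where h: "\<And>b. b \<in> Basis \<Longrightarrow> integrable M (h b)"
      "\<And>b E. b \<in> Basis \<Longrightarrow> E \<in> sets M \<Longrightarrow> m E \<bullet> b = (LINT x:E|M. h b x)"
    by metis
  define H where "H x = (\<Sum>b\<in>Basis. h b x *\<^sub>R b)" for x
  have iH: "integrable M H" unfolding H_def using h by auto
  have "m E = (LINT x:E|M. H x)" if E: "E \<in> sets M" for E
  proof (rule euclidean_eqI)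
    fix b :: 'b assume b: "b \<in> Basis"
    have "set_integrable M E H" using E iH by (auto intro: integrable_mult_indicator simp: set_integrable_def)
    then have "(LINT x:E|M. H x) \<bullet> b = (LINT x:E|M. H x \<bullet> b)"
      by (simp add: set_integrable_def set_lebesgue_integral_def integral_inner_left[symmetric])
    also have "\<dots> = (LINT x:E|M. h b x)"
      using b by (simp add: H_def inner_sum_left inner_Basis if_distrib cong: if_cong)
    finally show "m E \<bullet> b = (LINT x:E|M. H x) \<bullet> b" using h b E by simp
  qed
  with iH show ?thesis by blast
qed

section \<open>The total variation measure\<close>

lemma norm_sums_le_suminf_ennreal:
  fixes f :: "nat \<Rightarrow> 'b::banach"
  assumes "f sums s"
  shows "ennreal (norm s) \<le> (\<Sum>i. ennreal (norm (f i)))"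
proof (cases "(\<Sum>i. ennreal (norm (f i))) = \<infinity>")
  case False
  then have "summable (\<lambda>i. norm (f i))"
    by (intro summable_suminf_not_top) (auto simp: top_unique)
  then show ?thesis
    using assms summable_norm[of f] by (subst suminf_ennreal2) (auto simp: sums_iff intro!: ennreal_leI)
qed simp

text \<open>Every piece of a partition of \<open>E\<close> is a Borel subset of \<open>E\<close>.
  This is how null sets of a total variation are recognised later.\<close>

lemma variation_eq_0:
  assumes "\<And>A. A \<in> sets (restrict_space borel U) \<Longrightarrow> A \<subseteq> E \<Longrightarrow> \<mu> A = 0"
  shows "variation U \<mu> E = 0"
proof -
  have "variation U \<mu> E \<le> 0"
    unfolding variation_def
  proof (rule SUP_least)
    fix A :: "nat \<Rightarrow> 'a set"
    assume A: "A \<in> {A. range A \<subseteq> sets (restrict_space borel U) \<and> disjoint_family A \<and> (\<Union>i. A i) = E}"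
    then have "\<mu> (A i) = 0" for i by (intro assms) auto
    then show "(\<Sum>i. ennreal (norm (\<mu> (A i)))) \<le> 0" by simp
  qed
  then show ?thesis by simp
qed

context
  fixes U :: "'a::euclidean_space set" and \<mu> :: "'a set \<Rightarrow> 'b::euclidean_space"
begin

lemma variation_upper:
  assumes "range A \<subseteq> sets (restrict_space borel U)" "disjoint_family A"
  shows "(\<Sum>i::nat. ennreal (norm (\<mu> (A i)))) \<le> variation U \<mu> (\<Union>i. A i)"
  unfolding variation_def using assms
  by (rule_tac SUP_upper[where i = A]) simp

lemma variation_approx:
  assumes E: "E \<in> sets (restrict_space borel U)" and fin: "variation U \<mu> E \<noteq> \<infinity>" and "0 < e"
  obtains A :: "nat \<Rightarrow> 'a set" where "range A \<subseteq> sets (restrict_space borel U)" "disjoint_family A"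
    "(\<Union>i. A i) = E" "variation U \<mu> E \<le> (\<Sum>i. ennreal (norm (\<mu> (A i)))) + ennreal e"
proof -
  let ?P = "{A :: nat \<Rightarrow> 'a set. range A \<subseteq> sets (restrict_space borel U) \<and> disjoint_family A
               \<and> (\<Union>i. A i) = E}"
  \<comment> \<open>The one-piece partition, padded with empty sets, shows that the supremum runs
    over a nonempty family.\<close>
  have "(\<lambda>i. if i = 0 then E else {}) \<in> ?P"
    using E by (auto simp: disjoint_family_on_def split: if_splits)
  then have "?P \<noteq> {}" by blast
  from SUP_approx_ennreal[OF \<open>0 < e\<close> this variation_def fin]
  obtain A where "A \<in> ?P" "variation U \<mu> E < (\<Sum>i. ennreal (norm (\<mu> (A i)))) + ennreal e"
    by blast
  then show thesis by (intro that[of A]) (simp_all add: less_imp_le)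
qed

text \<open>Near-optimal partitions of the sets \<open>E j\<close>, with errors
  \<open>e / 2 ^ (j + 1)\<close> that add up to \<open>e\<close>, combine to a single partition of
  the union. Finiteness guarantees that near-optimal partitions exist.\<close>

lemma variation_countable_superadditive:
  fixes E :: "nat \<Rightarrow> 'a set"
  assumes E: "range E \<subseteq> sets (restrict_space borel U)" "disjoint_family E"
    and fin: "\<And>j. variation U \<mu> (E j) \<noteq> \<infinity>"
  shows "(\<Sum>j. variation U \<mu> (E j)) \<le> variation U \<mu> (\<Union>j. E j)"
proof (rule ennreal_le_epsilon)
  fix e :: real assume e: "0 < e"
  have "\<exists>A. range A \<subseteq> sets (restrict_space borel U) \<and> disjoint_family A \<and> (\<Union>i. A i) = E j \<and>
      variation U \<mu> (E j) \<le> (\<Sum>i::nat. ennreal (norm (\<mu> (A i)))) + ennreal (e * (1/2)^Suc j)" for j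
  proof -
    have "E j \<in> sets (restrict_space borel U)" "0 < e * (1/2)^Suc j" using E(1) e by auto
    from variation_approx[OF this(1) fin this(2)] show ?thesis by metis
  qed
  then obtain A where A: "\<And>j. range (A j) \<subseteq> sets (restrict_space borel U)"
      "\<And>j. disjoint_family (A j)" "\<And>j. (\<Union>i. A j i) = E j"
      "\<And>j. variation U \<mu> (E j) \<le> (\<Sum>i::nat. ennreal (norm (\<mu> (A j i)))) + ennreal (e * (1/2)^Suc j)"
    by metis
  \<comment> \<open>Partitions in \<open>variation\<close> are indexed by one natural number, so the
    doubly indexed pieces are enumerated through the pairing bijection.\<close>
  define B where "B n = case_prod A (prod_decode n)" for n
  have "B n \<in> sets (restrict_space borel U)" for n
    using A(1) by (auto simp: B_def split: prod.split)
  then have B1: "range B \<subseteq> sets (restrict_space borel U)" by auto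
  have "A j i \<inter> A j' i' = {}" if "(j, i) \<noteq> (j', i')" for j i j' i'
  proof (cases "j = j'")
    case True
    then show ?thesis using A(2)[of j] that by (auto simp: disjoint_family_on_def)
  next
    case False
    then have "E j \<inter> E j' = {}" using E(2) by (auto simp: disjoint_family_on_def)
    then show ?thesis using A(3) by blast
  qed
  then have B2: "disjoint_family B"
    unfolding B_def disjoint_family_on_def case_prod_beta
    by (metis (no_types) prod.collapse prod_decode_eq)
  have "(\<Union>n. B n) = (\<Union>p. case_prod A p)"
    unfolding B_def using surj_prod_decode by (metis image_image)
  also have "\<dots> = (\<Union>j. E j)" unfolding A(3)[symmetric] by auto
  finally have B3: "(\<Union>n. B n) = (\<Union>j. E j)" .
  have "(\<Sum>j. variation U \<mu> (E j)) \<le> (\<Sum>j. (\<Sum>i. ennreal (norm (\<mu> (A j i)))) + ennreal (e * (1/2)^Suc j))"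
    by (intro suminf_le A) auto
  also have "\<dots> = (\<Sum>j. \<Sum>i. ennreal (norm (\<mu> (A j i)))) + (\<Sum>j. ennreal (e * (1/2)^Suc j))"
    by (intro suminf_add[symmetric]) auto
  also have "(\<Sum>j. ennreal (e * (1/2)^Suc j)) = ennreal e"
    using e sums_mult[OF power_half_series, of e] by (subst suminf_ennreal2) (auto simp: sums_iff)
  also have "(\<Sum>j. \<Sum>i. ennreal (norm (\<mu> (A j i)))) = (\<Sum>n. ennreal (norm (\<mu> (B n))))"
    unfolding B_def by (rule suminf_ennreal_2dimen[symmetric]) simp
  also have "\<dots> \<le> variation U \<mu> (\<Union>j. E j)"
    using variation_upper[OF B1 B2] B3 by simp
  finally show "(\<Sum>j. variation U \<mu> (E j)) \<le> variation U \<mu> (\<Union>j. E j) + ennreal e"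
    by (simp add: add_right_mono)
qed

end

context
  fixes U :: "'a::euclidean_space set" and \<mu> :: "'a set \<Rightarrow> 'b::euclidean_space"
  assumes \<mu>: "finite_radon_measure U \<mu>"
begin

lemma finite_radon_measure_sums:
  fixes A :: "nat \<Rightarrow> 'a set"
  assumes "range A \<subseteq> sets (restrict_space borel U)" "disjoint_family A"
  shows "(\<lambda>i. \<mu> (A i)) sums \<mu> (\<Union>i. A i)"
proof -
  have "\<forall>A :: nat \<Rightarrow> 'a set. range A \<subseteq> sets (restrict_space borel U) \<and> disjoint_family A
       \<longrightarrow> (\<lambda>i. \<mu> (A i)) sums \<mu> (\<Union>i. A i)"
    using \<mu> unfolding finite_radon_measure_def by (elim conjE)
  from this[rule_format, OF conjI, OF assms] show ?thesis .
qed

lemma finite_radon_measure_empty: "\<mu> {} = 0"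
  using \<mu> unfolding finite_radon_measure_def by (elim conjE)

lemma finite_variation: "variation U \<mu> U < \<infinity>"
  using \<mu> unfolding finite_radon_measure_def by (elim conjE)

text \<open>A partition of \<open>E\<close> becomes one of \<open>U\<close> by adding the piece
  \<open>U - E\<close>, which can only enlarge the sum. Monotonicity is argued by hand because
  \<open>variation\<close> is not yet known to be a measure.\<close>

lemma variation_le_variation_space:
  assumes E: "E \<in> sets (restrict_space borel U)"
  shows "variation U \<mu> E \<le> variation U \<mu> U"
  unfolding variation_def[of U \<mu> E]
proof (rule SUP_least)
  fix A :: "nat \<Rightarrow> 'a set"
  assume "A \<in> {A. range A \<subseteq> sets (restrict_space borel U) \<and> disjoint_family A \<and> (\<Union>i. A i) = E}"
  then have A: "range A \<subseteq> sets (restrict_space borel U)" "disjoint_family A" "(\<Union>i. A i) = E" by auto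
  have EU: "E \<subseteq> U" using sets.sets_into_space[OF E] by (simp add: space_restrict_space)
  \<comment> \<open>Index 0 holds the new piece; the old pieces move up by one.\<close>
  define B where "B i = (case i of 0 \<Rightarrow> U - E | Suc i \<Rightarrow> A i)" for i
  have "U - E \<in> sets (restrict_space borel U)"
    using sets.compl_sets[OF E] by (simp add: space_restrict_space)
  then have B1: "range B \<subseteq> sets (restrict_space borel U)"
    using A by (auto simp: B_def split: nat.split)
  have B2: "disjoint_family B"
    unfolding disjoint_family_on_def
  proof (intro ballI impI)
    fix i j :: nat assume "i \<noteq> j"
    then show "B i \<inter> B j = {}"
      using A(2,3) by (cases i; cases j) (auto simp: B_def disjoint_family_on_def)
  qed
  have B3: "(\<Union>i. B i) = U"
  proof -
    have "(\<Union>i. B i) = B 0 \<union> (\<Union>i. B (Suc i))" by (subst UNIV_nat_eq) auto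
    also have "\<dots> = U" using A(3) EU by (auto simp: B_def)
    finally show ?thesis .
  qed
  have "(\<Sum>i. ennreal (norm (\<mu> (A i)))) = (\<Sum>i. ennreal (norm (\<mu> (B (Suc i)))))" by (simp add: B_def)
  also have "\<dots> \<le> (\<Sum>i. ennreal (norm (\<mu> (B i))))"
    by (subst (2) suminf_offset[of _ 1]) auto
  also have "\<dots> \<le> variation U \<mu> U" using variation_upper[OF B1 B2, of \<mu>] B3 by simp
  finally show "(\<Sum>i. ennreal (norm (\<mu> (A i)))) \<le> variation U \<mu> U" .
qed

lemma variation_finite: "E \<in> sets (restrict_space borel U) \<Longrightarrow> variation U \<mu> E \<noteq> \<infinity>"
  using le_less_trans[OF variation_le_variation_space[of E] finite_variation] by auto

text \<open>A partition \<open>A\<close> of the union is refined by the sets \<open>E j\<close>: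
  countable additivity of \<open>\<mu>\<close> bounds \<open>norm (\<mu> (A i))\<close> by the sum
  over \<open>j\<close>, and after exchanging the sums the pieces \<open>A i \<inter> E j\<close>
  partition \<open>E j\<close>.\<close>

lemma variation_countable_subadditive:
  fixes E :: "nat \<Rightarrow> 'a set"
  assumes E: "range E \<subseteq> sets (restrict_space borel U)" "disjoint_family E"
  shows "variation U \<mu> (\<Union>j. E j) \<le> (\<Sum>j. variation U \<mu> (E j))"
  unfolding variation_def[of U \<mu> "\<Union>j. E j"]
proof (rule SUP_least)
  fix A :: "nat \<Rightarrow> 'a set"
  assume "A \<in> {A. range A \<subseteq> sets (restrict_space borel U) \<and> disjoint_family A \<and> (\<Union>i. A i) = (\<Union>j. E j)}"
  then have A: "range A \<subseteq> sets (restrict_space borel U)" "disjoint_family A" "(\<Union>i. A i) = (\<Union>j. E j)" by auto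
  have AE: "A i \<inter> E j \<in> sets (restrict_space borel U)" for i j
    using A(1) E(1) by (intro sets.Int) auto
  have "(\<Sum>i. ennreal (norm (\<mu> (A i)))) \<le> (\<Sum>i. \<Sum>j. ennreal (norm (\<mu> (A i \<inter> E j))))"
  proof (intro suminf_le)
    fix i
    have "(\<Union>j. A i \<inter> E j) = A i" using A(3) by blast
    moreover have "disjoint_family (\<lambda>j. A i \<inter> E j)"
      using E(2) unfolding disjoint_family_on_def by blast
    then have "(\<lambda>j. \<mu> (A i \<inter> E j)) sums \<mu> (\<Union>j. A i \<inter> E j)"
      using AE by (intro finite_radon_measure_sums) auto
    ultimately show "ennreal (norm (\<mu> (A i))) \<le> (\<Sum>j. ennreal (norm (\<mu> (A i \<inter> E j))))"
      using norm_sums_le_suminf_ennreal by metis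
  qed auto
  \<comment> \<open>The exchange of the two sums is done by reading the outer one as an integral for
    counting measure.\<close>
  also have "\<dots> = (\<Sum>j. \<Sum>i. ennreal (norm (\<mu> (A i \<inter> E j))))"
    unfolding nn_integral_count_space_nat[symmetric, of "\<lambda>i. \<Sum>j. ennreal (norm (\<mu> (A i \<inter> E j)))"]
    by (subst nn_integral_suminf) (auto simp: nn_integral_count_space_nat)
  also have "\<dots> \<le> (\<Sum>j. variation U \<mu> (E j))"
  proof (intro suminf_le)
    fix j
    have "(\<Union>i. A i \<inter> E j) = E j" using A(3) by blast
    moreover have "disjoint_family (\<lambda>i. A i \<inter> E j)"
      using A(2) unfolding disjoint_family_on_def by blast
    then have "(\<Sum>i. ennreal (norm (\<mu> (A i \<inter> E j)))) \<le> variation U \<mu> (\<Union>i. A i \<inter> E j)"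
      using AE by (intro variation_upper) blast
    ultimately show "(\<Sum>i. ennreal (norm (\<mu> (A i \<inter> E j)))) \<le> variation U \<mu> (E j)"
      by simp
  qed auto
  finally show "(\<Sum>i. ennreal (norm (\<mu> (A i)))) \<le> (\<Sum>j. variation U \<mu> (E j))" .
qed

lemma space_total_variation [simp]: "space (total_variation U \<mu>) = U"
  and sets_total_variation [simp, measurable_cong]:
    "sets (total_variation U \<mu>) = sets (restrict_space borel U)"
proof -
  have "sets (restrict_space borel U) \<subseteq> Pow U"
    using sets.space_closed[of "restrict_space borel U"] by (simp add: space_restrict_space)
  moreover have "sigma_algebra U (sets (restrict_space borel U))"
    using sets.sigma_algebra_axioms[of "restrict_space borel U"] by (simp add: space_restrict_space)
  ultimately show "space (total_variation U \<mu>) = U"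
      "sets (total_variation U \<mu>) = sets (restrict_space borel U)"
    by (auto simp: total_variation_def space_measure_of_conv sets_measure_of_conv
        sigma_algebra.sigma_sets_eq)
qed

text \<open>\<open>measure_of\<close> takes on the prescribed values only for a countably additive
  set function; the two inequalities above provide that, and finiteness of the variation allows the
  use of superadditivity.\<close>

lemma emeasure_total_variation:
  assumes "E \<in> sets (restrict_space borel U)"
  shows "emeasure (total_variation U \<mu>) E = variation U \<mu> E"
proof (rule emeasure_measure_of[OF total_variation_def])
  show "sets (restrict_space borel U) \<subseteq> Pow U"
    using sets.space_closed[of "restrict_space borel U"] by (simp add: space_restrict_space)
  have "variation U \<mu> {} = 0"
    using finite_radon_measure_empty by (intro variation_eq_0) auto
  then show "positive (sets (total_variation U \<mu>)) (variation U \<mu>)" by (simp add: positive_def)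
  show "countably_additive (sets (total_variation U \<mu>)) (variation U \<mu>)"
  proof (rule countably_additiveI)
    fix E :: "nat \<Rightarrow> 'a set"
    assume "range E \<subseteq> sets (total_variation U \<mu>)" "disjoint_family E"
    then show "(\<Sum>i. variation U \<mu> (E i)) = variation U \<mu> (\<Union> (range E))"
      by (intro antisym variation_countable_superadditive variation_countable_subadditive variation_finite)
         auto
  qed
qed (use assms in auto)

lemma finite_measure_total_variation: "finite_measure (total_variation U \<mu>)"
proof (rule finite_measureI)
  have "U \<in> sets (restrict_space borel U)"
    using sets.top[of "restrict_space borel U"] by (simp add: space_restrict_space)
  then show "emeasure (total_variation U \<mu>) (space (total_variation U \<mu>)) \<noteq> \<infinity>"
    using variation_finite by (simp add: emeasure_total_variation)
qed

lemma norm_le_variation: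
  assumes E: "E \<in> sets (restrict_space borel U)"
  shows "ennreal (norm (\<mu> E)) \<le> variation U \<mu> E"
proof -
  let ?A = "\<lambda>i::nat. if i = 0 then E else {}"
  have "range ?A \<subseteq> sets (restrict_space borel U)" "disjoint_family ?A" "(\<Union>i. ?A i) = E"
    using E by (auto simp: disjoint_family_on_def split: if_splits)
  then have "(\<Sum>i. ennreal (norm (\<mu> (?A i)))) \<le> variation U \<mu> E"
    using variation_upper[of ?A U \<mu>] by metis
  moreover have "(\<Sum>i. ennreal (norm (\<mu> (?A i)))) = ennreal (norm (\<mu> E))"
    using finite_radon_measure_empty by (subst suminf_finite[of "{0}"]) auto
  ultimately show ?thesis by simp
qed

lemma norm_le_total_variation:
  assumes E: "E \<in> sets (restrict_space borel U)"
  shows "norm (\<mu> E) \<le> measure (total_variation U \<mu>) E"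
proof -
  have "enn2real (ennreal (norm (\<mu> E))) \<le> enn2real (variation U \<mu> E)"
    using norm_le_variation[OF E] variation_finite[OF E] by (intro enn2real_mono) (auto simp: top.not_eq_extremum)
  then show ?thesis by (simp add: measure_def emeasure_total_variation[OF E])
qed

text \<open>Radon-Nikodym with \<open>M\<close> the total variation itself, which dominates
  \<open>\<mu>\<close>. Existence makes the \<open>SOME\<close> in \<open>vec_RN_deriv\<close>
  meaningful.\<close>

lemma polar_density:
  shows integrable_polar_density: "integrable (total_variation U \<mu>) (polar_density U \<mu>)"
    and polar_density_eq: "\<And>E. E \<in> sets (restrict_space borel U)
      \<Longrightarrow> \<mu> E = (LINT x:E|total_variation U \<mu>. polar_density U \<mu> x)"
proof -
  have "\<exists>h. integrable (total_variation U \<mu>) h \<and>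
      (\<forall>E\<in>sets (total_variation U \<mu>). \<mu> E = (LINT x:E|total_variation U \<mu>. h x))"
    by (rule vector_Radon_Nikodym[OF finite_measure_total_variation], unfold sets_total_variation)
       (fact finite_radon_measure_sums norm_le_total_variation)+
  from someI_ex[OF this]
  show "integrable (total_variation U \<mu>) (polar_density U \<mu>)"
    "\<And>E. E \<in> sets (restrict_space borel U)
      \<Longrightarrow> \<mu> E = (LINT x:E|total_variation U \<mu>. polar_density U \<mu> x)"
    unfolding polar_density_def vec_RN_deriv_def by auto
qed

end

section \<open>Lebesgue decomposition\<close>

lemma integrable_bounded_scaleR:
  fixes h :: "'a \<Rightarrow> 'b::euclidean_space"
  assumes h: "integrable M h" and [measurable]: "k \<in> borel_measurable M"
    and B: "\<And>x. x \<in> space M \<Longrightarrow> \<bar>k x\<bar> \<le> B"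
  shows "integrable M (\<lambda>x. k x *\<^sub>R h x)"
proof (rule Bochner_Integration.integrable_bound)
  show "integrable M (\<lambda>x. B *\<^sub>R h x)" using h by simp
  have [measurable]: "h \<in> borel_measurable M" using h by auto
  show "(\<lambda>x. k x *\<^sub>R h x) \<in> borel_measurable M" by measurable
  show "AE x in M. norm (k x *\<^sub>R h x) \<le> norm (B *\<^sub>R h x)"
  proof (rule AE_I2)
    fix x assume "x \<in> space M"
    then have "\<bar>k x\<bar> \<le> \<bar>B\<bar>" using B[of x] by simp
    then show "norm (k x *\<^sub>R h x) \<le> norm (B *\<^sub>R h x)" by (simp add: mult_right_mono)
  qed
qed

text \<open>An identity between vector measures, each given by a density over its own base measure,
  passes from sets to bounded weights by approximation with simple functions. It will be tested
  against the mollifying kernel. The bound on \<open>k\<close> is stated existentially so that it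
  can change along the induction.\<close>

lemma integral_scaleR_eq_if_set_integral_eq:
  fixes h1 h2 h3 :: "'a \<Rightarrow> 'b::euclidean_space"
  assumes [measurable_cong]: "sets M2 = sets M1" "sets M3 = sets M1"
    and h: "integrable M1 h1" "integrable M2 h2" "integrable M3 h3"
    and eq: "\<And>E. E \<in> sets M1 \<Longrightarrow>
        (LINT x:E|M1. h1 x) = (LINT x:E|M2. h2 x) + (LINT x:E|M3. h3 x)"
    and k: "k \<in> borel_measurable M1" "\<And>x. 0 \<le> k x" and B: "\<exists>B. \<forall>x\<in>space M1. k x \<le> B"
  shows "(LINT x|M1. k x *\<^sub>R h1 x) = (LINT x|M2. k x *\<^sub>R h2 x) + (LINT x|M3. k x *\<^sub>R h3 x)"
  using k B
proof (induction rule: borel_measurable_induct_real)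
  have sp: "space M2 = space M1" "space M3 = space M1"
    by (simp_all add: assms(1,2)[THEN sets_eq_imp_space_eq])
  have int: "integrable M1 (\<lambda>x. u x *\<^sub>R h1 x)" "integrable M2 (\<lambda>x. u x *\<^sub>R h2 x)"
      "integrable M3 (\<lambda>x. u x *\<^sub>R h3 x)"
    if "u \<in> borel_measurable M1" "\<And>x. 0 \<le> u x" "\<forall>x\<in>space M1. u x \<le> B" for u B
    using that h by (auto intro!: integrable_bounded_scaleR[where B = B] simp: sp assms(1,2) cong: measurable_cong_sets)
  {
    case (set A)
    then show ?case using eq[of A] by (simp add: set_lebesgue_integral_def)
  next
    case (mult u c)
    show ?case
    \<comment> \<open>A bound on \<open>c * u\<close> gives one on \<open>u\<close> only if
      \<open>c\<close> is nonzero; for \<open>c = 0\<close> all integrals vanish.\<close>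
    proof (cases "c = 0")
      case False
      from mult.prems obtain B where "\<forall>x\<in>space M1. c * u x \<le> B" by blast
      then have "\<forall>x\<in>space M1. u x \<le> B / c" using mult.hyps False by (auto simp: field_simps)
      with mult.IH have "(LINT x|M1. u x *\<^sub>R h1 x) = (LINT x|M2. u x *\<^sub>R h2 x) + (LINT x|M3. u x *\<^sub>R h3 x)"
        by blast
      then show ?thesis by (simp flip: scaleR_scaleR add: scaleR_add_right)
    qed simp
  next
    case (add u v)
    from add.prems obtain B where B: "\<forall>x\<in>space M1. v x + u x \<le> B" by blast
    have m: "u \<in> borel_measurable M1" "v \<in> borel_measurable M1" and nn: "\<And>x. 0 \<le> u x" "\<And>x. 0 \<le> v x"
      using add by blast+
    have Bu: "\<forall>x\<in>space M1. u x \<le> B"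
    proof
      fix x assume "x \<in> space M1" then have "v x + u x \<le> B" using B by blast
      then show "u x \<le> B" using nn(2)[of x] by linarith
    qed
    have Bv: "\<forall>x\<in>space M1. v x \<le> B"
    proof
      fix x assume "x \<in> space M1" then have "v x + u x \<le> B" using B by blast
      then show "v x \<le> B" using nn(1)[of x] by linarith
    qed
    have "(LINT x|M1. u x *\<^sub>R h1 x) = (LINT x|M2. u x *\<^sub>R h2 x) + (LINT x|M3. u x *\<^sub>R h3 x)"
        "(LINT x|M1. v x *\<^sub>R h1 x) = (LINT x|M2. v x *\<^sub>R h2 x) + (LINT x|M3. v x *\<^sub>R h3 x)"
      using add.IH Bu Bv by blast+
    then show ?case
      using int[OF m(1) nn(1) Bu] int[OF m(2) nn(2) Bv] by (simp add: scaleR_add_left)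
  next
    case (seq S)
    from seq.prems obtain B where B: "\<forall>x\<in>space M1. k x \<le> B" by blast
    \<comment> \<open>The approximants increase to \<open>k\<close> and therefore share its bound,
      which supplies the dominating function for all three integrals.\<close>
    have le: "S i x \<le> k x" if "x \<in> space M1" for i x
      using seq that by (intro incseq_le) (auto simp: incseq_def le_fun_def)
    then have SB: "\<forall>x\<in>space M1. S i x \<le> B" for i using B by (meson order_trans)
    have lim: "(\<lambda>i. LINT x|M. S i x *\<^sub>R h x) \<longlonglongrightarrow> (LINT x|M. k x *\<^sub>R h x)"
      if sM: "sets M = sets M1" and h: "integrable M h" for M and h :: "'a \<Rightarrow> 'b"
    proof (rule integral_dominated_convergence[where w = "\<lambda>x. norm (B *\<^sub>R h x)"])
      have sp: "space M = space M1" using sM by (rule sets_eq_imp_space_eq)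
      have [measurable]: "h \<in> borel_measurable M" "k \<in> borel_measurable M" "\<And>i. S i \<in> borel_measurable M"
        using borel_measurable_integrable[OF h] k(1) seq.hyps(1) measurable_cong_sets[OF sM refl, of borel]
        by auto
      show "(\<lambda>x. k x *\<^sub>R h x) \<in> borel_measurable M" "\<And>i. (\<lambda>x. S i x *\<^sub>R h x) \<in> borel_measurable M"
        by measurable
      show "integrable M (\<lambda>x. norm (B *\<^sub>R h x))" using h by simp
      show "AE x in M. (\<lambda>i. S i x *\<^sub>R h x) \<longlonglongrightarrow> k x *\<^sub>R h x"
        using seq.hyps(4) sp by (auto intro!: tendsto_intros)
      show "AE x in M. norm (S i x *\<^sub>R h x) \<le> norm (B *\<^sub>R h x)" for i

      proof (rule AE_I2)
        fix x assume "x \<in> space M"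
        then have "\<bar>S i x\<bar> \<le> \<bar>B\<bar>" using SB[of i] seq.hyps(2)[of i x] sp by fastforce
        then show "norm (S i x *\<^sub>R h x) \<le> norm (B *\<^sub>R h x)" by (simp add: mult_right_mono)
      qed
    qed
    have "(LINT x|M1. S i x *\<^sub>R h1 x) = (LINT x|M2. S i x *\<^sub>R h2 x) + (LINT x|M3. S i x *\<^sub>R h3 x)" for i
      using seq.IH SB by blast
    then have "(\<lambda>i. LINT x|M1. S i x *\<^sub>R h1 x) \<longlonglongrightarrow>
        (LINT x|M2. k x *\<^sub>R h2 x) + (LINT x|M3. k x *\<^sub>R h3 x)"
      using tendsto_add[OF lim[OF assms(1) h(2)] lim[OF assms(2) h(3)]] by simp
    then show ?case using lim[OF refl h(1)] LIMSEQ_unique by blast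
  }
qed

section \<open>Sums of measures on a common sigma-algebra, and mutual singularity\<close>

definition measure_plus :: "'a measure \<Rightarrow> 'a measure \<Rightarrow> 'a measure"
  where "measure_plus M N = measure_of (space M) (sets M) (\<lambda>A. emeasure M A + emeasure N A)"

lemma space_measure_plus [simp]: "space (measure_plus M N) = space M"
  and sets_measure_plus [simp, measurable_cong]: "sets (measure_plus M N) = sets M"
  by (simp_all add: measure_plus_def)

lemma emeasure_measure_plus:
  assumes "sets N = sets M" "A \<in> sets M"
  shows "emeasure (measure_plus M N) A = emeasure M A + emeasure N A"
proof (rule emeasure_measure_of[OF measure_plus_def])
  show "countably_additive (sets (measure_plus M N)) (\<lambda>A. emeasure M A + emeasure N A)"
  proof (rule countably_additiveI)
    fix A :: "nat \<Rightarrow> 'a set" assume A: "range A \<subseteq> sets (measure_plus M N)" "disjoint_family A"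
    have "(\<Sum>i. emeasure M (A i) + emeasure N (A i)) = (\<Sum>i. emeasure M (A i)) + (\<Sum>i. emeasure N (A i))"
      by (rule suminf_add[symmetric]) auto
    then show "(\<Sum>i. emeasure M (A i) + emeasure N (A i)) = emeasure M (\<Union>(range A)) + emeasure N (\<Union>(range A))"
      using A assms by (simp add: suminf_emeasure)
  qed
qed (use assms sets.space_closed in \<open>auto simp: positive_def\<close>)

lemma finite_measure_plus:
  assumes "sets N = sets M" "finite_measure M" "finite_measure N"
  shows "finite_measure (measure_plus M N)"
proof (rule finite_measureI)
  have "space N = space M" using assms(1) by (rule sets_eq_imp_space_eq)
  then show "emeasure (measure_plus M N) (space (measure_plus M N)) \<noteq> \<infinity>"
    using assms finite_measure.emeasure_finite[of M "space M"] finite_measure.emeasure_finite[of N "space M"]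
    by (simp add: emeasure_measure_plus)
qed

text \<open>Since \<open>S\<close> is null for \<open>M\<close> and its complement is null for
  \<open>N\<close>, cutting the sum down to either side removes exactly the other summand.\<close>

lemma density_measure_plus_singular:
  assumes NM: "sets N = sets M" and S: "S \<in> sets M" and "emeasure M S = 0" "emeasure N (space N - S) = 0"
  shows "density (measure_plus M N) (indicator (space M - S)) = M"
    and "density (measure_plus M N) (indicator S) = N"
proof -
  have sp: "space N = space M" using NM by (rule sets_eq_imp_space_eq)
  have z: "emeasure M (S \<inter> A) = 0" "emeasure N ((space M - S) \<inter> A) = 0" if "A \<in> sets M" for A
  proof -
    have "S \<in> null_sets M" "space M - S \<in> null_sets N" using assms sp by auto
    then show "emeasure M (S \<inter> A) = 0" "emeasure N ((space M - S) \<inter> A) = 0"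
      using that NM null_set_Int2[of S M A] null_set_Int2[of "space M - S" N A] by auto
  qed
  have M: "emeasure M ((space M - S) \<inter> A) = emeasure M A" if A: "A \<in> sets M" for A
  proof -
    have "emeasure M A = emeasure M (((space M - S) \<inter> A) \<union> (S \<inter> A))"
      using sets.sets_into_space[OF A] by (intro arg_cong[where f = "emeasure M"]) auto
    also have "\<dots> = emeasure M ((space M - S) \<inter> A) + emeasure M (S \<inter> A)"
      using A S by (intro plus_emeasure[symmetric]) auto
    finally show ?thesis using z A by simp
  qed
  have N: "emeasure N (S \<inter> A) = emeasure N A" if A: "A \<in> sets M" for A
  proof -
    have "emeasure N A = emeasure N (((space M - S) \<inter> A) \<union> (S \<inter> A))"
      using sets.sets_into_space[OF A] by (intro arg_cong[where f = "emeasure N"]) auto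
    also have "\<dots> = emeasure N ((space M - S) \<inter> A) + emeasure N (S \<inter> A)"
      using A S NM by (intro plus_emeasure[symmetric]) auto
    finally show ?thesis using z A by simp
  qed
  show "density (measure_plus M N) (indicator (space M - S)) = M"
    using NM S z M by (intro measure_eqI) (auto simp: emeasure_measure_plus emeasure_restricted)
  show "density (measure_plus M N) (indicator S) = N"
    using NM S z N by (intro measure_eqI) (auto simp: emeasure_measure_plus emeasure_restricted)
qed

lemma ac_part_exists:
  fixes U :: "'a::euclidean_space set" and \<mu> :: "'a set \<Rightarrow> 'b::euclidean_space"
  assumes "open U" "bounded U" and \<mu>: "finite_radon_measure U \<mu>"
  shows "\<exists>f. set_integrable lborel U f \<and> finite_radon_measure U (minus_density \<mu> f) \<and>
     lebesgue_singular U (total_variation U (minus_density \<mu> f))"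
proof -
  \<comment> \<open>With \<open>\<Lambda> = L + V\<close>, \<open>\<mu> = w \<Lambda>\<close> and \<open>L = D \<Lambda>\<close>, the singular part lives on \<open>S = {D = 0}\<close> and the
    density is \<open>w / D\<close> off \<open>S\<close>.\<close>
  define V where "V = total_variation U \<mu>"
  define L :: "'a measure" where "L = restrict_space lborel U"
  define \<Lambda> where "\<Lambda> = measure_plus L V"
  let ?S = "sets (restrict_space borel U)"
  have U: "U \<in> sets borel" using \<open>open U\<close> by simp
  have sL [measurable_cong]: "sets L = ?S" unfolding L_def by (rule sets_restrict_space_cong) simp
  have [simp]: "space L = U" "space \<Lambda> = U" by (simp_all add: L_def \<Lambda>_def space_restrict_space)
  have sV: "sets V = sets L" using \<mu> by (simp add: V_def sL)
  have s\<Lambda> [measurable_cong]: "sets \<Lambda> = ?S" by (simp add: \<Lambda>_def sL)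
  have US: "U \<in> ?S" using sets.top[of "restrict_space borel U"] by (simp add: space_restrict_space)
  have SB: "E \<in> sets borel" "E \<subseteq> U" if "E \<in> ?S" for E
    using that U by (auto simp: sets_restrict_space)
  have eL: "emeasure L E = emeasure lborel E" if "E \<in> ?S" for E
    unfolding L_def using SB[OF that] U by (intro emeasure_restrict_space) auto
  have fV: "finite_measure V" unfolding V_def using \<mu> by (rule finite_measure_total_variation)
  have fL: "finite_measure L"
  proof (rule finite_measureI)
    show "emeasure L (space L) \<noteq> \<infinity>"
      using emeasure_bounded_finite[OF \<open>bounded U\<close>] eL[OF US] by simp
  qed
  have f\<Lambda>: "finite_measure \<Lambda>" unfolding \<Lambda>_def using sV fL fV by (rule finite_measure_plus)
  have e\<Lambda>: "emeasure \<Lambda> E = emeasure L E + emeasure V E" if "E \<in> ?S" for E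
    unfolding \<Lambda>_def using that sV sL by (simp add: emeasure_measure_plus)
  have "absolutely_continuous \<Lambda> L"
    unfolding absolutely_continuous_def using e\<Lambda> by (auto simp: null_sets_def s\<Lambda> sL)
  then obtain D :: "'a \<Rightarrow> real" where D [measurable]: "D \<in> borel_measurable \<Lambda>" and D0: "\<And>x. 0 \<le> D x"
    and dens: "density \<Lambda> (\<lambda>x. ennreal (D x)) = L"
    using finite_measure_real_density[OF f\<Lambda> fL] s\<Lambda> sL by metis
  have "\<exists>h. integrable \<Lambda> h \<and> (\<forall>E\<in>sets \<Lambda>. \<mu> E = (LINT x:E|\<Lambda>. h x))"
  \<comment> \<open>\<open>\<Lambda>\<close> dominates \<open>\<mu>\<close> because it already
    dominates the total variation \<open>V\<close>.\<close>
  proof (rule vector_Radon_Nikodym[OF f\<Lambda>])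
    fix E assume E: "E \<in> sets \<Lambda>"
    have "norm (\<mu> E) \<le> measure V E"
      using norm_le_total_variation[OF \<mu>] E by (simp add: V_def s\<Lambda>)
    also have "\<dots> \<le> measure \<Lambda> E"
      unfolding measure_def using e\<Lambda>[of E] E f\<Lambda>
      by (intro enn2real_mono) (auto simp: s\<Lambda> finite_measure.emeasure_finite less_top[symmetric])
    finally show "norm (\<mu> E) \<le> measure \<Lambda> E" .
  qed (use finite_radon_measure_sums[OF \<mu>] in \<open>simp add: s\<Lambda>\<close>)
  then obtain w where w: "integrable \<Lambda> w" and \<mu>w: "\<And>E. E \<in> ?S \<Longrightarrow> \<mu> E = (LINT x:E|\<Lambda>. w x)"
    using s\<Lambda> by metis
  have [measurable]: "w \<in> borel_measurable \<Lambda>" using w by auto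
  define S where "S = {x\<in>space \<Lambda>. D x = 0}"
  have "S \<in> sets \<Lambda>" unfolding S_def by measurable
  then have S: "S \<in> ?S" "S \<subseteq> U" by (auto simp: S_def s\<Lambda>)
  have US': "U - S \<in> ?S" using US S by blast
  \<comment> \<open>The value 0 on \<open>S\<close> makes \<open>D f\<close> equal to
    \<open>w\<close> off \<open>S\<close> and to 0 on \<open>S\<close>, so that \<open>f\<close>
    integrates over \<open>E\<close> to \<open>\<mu> (E - S)\<close>.\<close>
  define f where "f x = (if D x = 0 then 0 else w x /\<^sub>R D x)" for x
  have [measurable]: "f \<in> borel_measurable \<Lambda>" unfolding f_def by measurable
  have Df: "D x *\<^sub>R f x = (if D x = 0 then 0 else w x)" for x by (simp add: f_def)
  have intw: "integrable \<Lambda> (\<lambda>x. indicator E x *\<^sub>R w x)" if "E \<in> ?S" for E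
    using that w s\<Lambda> by (intro integrable_mult_indicator) auto
  have "integrable \<Lambda> (\<lambda>x. D x *\<^sub>R f x)"
    using intw[OF US'] by (rule Bochner_Integration.integrable_cong[THEN iffD1, rotated 2])
      (auto simp: Df S_def indicator_def)
  then have fL': "integrable L f"
    unfolding dens[symmetric] using D0 by (subst integrable_density) auto
  have setL: "(LINT x:E|lborel. f x) = (LINT x:E|L. f x)" if E: "E \<in> ?S" for E
    unfolding set_lebesgue_integral_def L_def using U SB[OF E]
    by (subst integral_restrict_space) (auto intro!: Bochner_Integration.integral_cong simp: indicator_def)
  have f_int: "(LINT x:E|lborel. f x) = \<mu> (E - S)" if E: "E \<in> ?S" for E
  proof -
    have [measurable]: "E \<in> sets \<Lambda>" using E s\<Lambda> by simp
    have ES: "E - S \<in> ?S" using E S by blast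
    have "(LINT x:E|L. f x) = (LINT x|\<Lambda>. D x *\<^sub>R (indicator E x *\<^sub>R f x))"
      unfolding set_lebesgue_integral_def dens[symmetric] using D0 by (subst integral_density) auto
    also have "\<dots> = (LINT x:E - S|\<Lambda>. w x)"
      unfolding set_lebesgue_integral_def
      by (intro Bochner_Integration.integral_cong) (auto simp: f_def S_def indicator_def)
    finally show ?thesis using setL[OF E] \<mu>w[OF ES] by simp
  qed
  \<comment> \<open>The remainder is the restriction of \<open>\<mu>\<close> to \<open>S\<close>;
    additivity, finiteness and singularity are all read off from this formula.\<close>
  have m: "minus_density \<mu> f E = \<mu> (E \<inter> S)" if E: "E \<in> ?S" for E
  proof -
    have ES: "E - S \<in> ?S" "E \<inter> S \<in> ?S" using E S by blast+
    have "\<mu> E = \<mu> (E - S) + \<mu> (E \<inter> S)"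
      unfolding \<mu>w[OF E] \<mu>w[OF ES(1)] \<mu>w[OF ES(2)] set_lebesgue_integral_def
        Bochner_Integration.integral_add[OF intw[OF ES(1)] intw[OF ES(2)], symmetric]
      by (intro Bochner_Integration.integral_cong) (auto simp: indicator_def)
    then show ?thesis using f_int[OF E] by (simp add: minus_density_def)
  qed
  have "set_integrable lborel U f"
    using fL' U unfolding L_def set_integrable_def by (subst (asm) integrable_restrict_space) auto
  moreover have fin: "finite_radon_measure U (minus_density \<mu> f)"
    unfolding finite_radon_measure_def
  proof (intro conjI allI impI)
    show "minus_density \<mu> f {} = 0" using m[of "{}"] finite_radon_measure_empty[OF \<mu>] by simp
  next
    fix A :: "nat \<Rightarrow> 'a set" assume A: "range A \<subseteq> ?S \<and> disjoint_family A"
    have "range (\<lambda>i. A i \<inter> S) \<subseteq> ?S" using A S by blast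
    moreover have "disjoint_family (\<lambda>i. A i \<inter> S)" using A unfolding disjoint_family_on_def by blast
    ultimately have "(\<lambda>i. \<mu> (A i \<inter> S)) sums \<mu> (\<Union>i. A i \<inter> S)" by (rule finite_radon_measure_sums[OF \<mu>])
    moreover have "(\<Union>i. A i \<inter> S) = (\<Union>i. A i) \<inter> S" by blast
    moreover have "(\<Union>i. A i) \<in> ?S" using A by blast
    moreover have "\<And>i. A i \<in> ?S" using A by blast
    ultimately show "(\<lambda>i. minus_density \<mu> f (A i)) sums minus_density \<mu> f (\<Union>i. A i)"
      using m by simp
  next
    have "variation U (minus_density \<mu> f) U \<le> variation U \<mu> S"
      unfolding variation_def[of U "minus_density \<mu> f" U]
    proof (rule SUP_least)
      fix A :: "nat \<Rightarrow> 'a set"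
      assume "A \<in> {A. range A \<subseteq> ?S \<and> disjoint_family A \<and> (\<Union>i. A i) = U}"
      then have A: "range A \<subseteq> ?S" "disjoint_family A" "(\<Union>i. A i) = U" by blast+
      have "range (\<lambda>i. A i \<inter> S) \<subseteq> ?S" using A S by blast
      moreover have "disjoint_family (\<lambda>i. A i \<inter> S)" using A unfolding disjoint_family_on_def by blast
      ultimately have "(\<Sum>i. ennreal (norm (\<mu> (A i \<inter> S)))) \<le> variation U \<mu> (\<Union>i. A i \<inter> S)"
        by (rule variation_upper)
      moreover have "(\<Union>i. A i \<inter> S) = S" using A(3) S by blast
      moreover have "\<And>i. A i \<in> ?S" using A by blast
      ultimately show "(\<Sum>i. ennreal (norm (minus_density \<mu> f (A i)))) \<le> variation U \<mu> S"
        using m by simp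
    qed
    also have "\<dots> < \<infinity>" using variation_finite[OF \<mu> S(1)] by (simp add: less_top[symmetric])
    finally show "variation U (minus_density \<mu> f) U < \<infinity>" .
  qed
  moreover have "lebesgue_singular U (total_variation U (minus_density \<mu> f))"
    unfolding lebesgue_singular_def
  proof (intro bexI conjI)
    have "S \<in> null_sets L"
      unfolding dens[symmetric] using S s\<Lambda> by (subst null_sets_density_iff) (auto simp: S_def)
    then show "emeasure lborel S = 0" using eL[OF S(1)] by auto
    show "emeasure (total_variation U (minus_density \<mu> f)) (U - S) = 0"
      unfolding emeasure_total_variation[OF fin US']
    proof (rule variation_eq_0)
      fix A assume A: "A \<in> ?S" "A \<subseteq> U - S"
      then have "A \<inter> S = {}" by blast
      then show "minus_density \<mu> f A = 0" using m[OF A(1)] finite_radon_measure_empty[OF \<mu>] by simp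
    qed
  qed (use S in auto)
  ultimately show ?thesis by blast
qed

text \<open>Existence transfers to the chosen density. From here on \<open>ac_part\<close> is used
  only through these three properties.\<close>

lemma ac_part_props:
  assumes "open U" "bounded U" "finite_radon_measure U \<mu>"
  shows set_integrable_ac_part: "set_integrable lborel U (ac_part U \<mu>)"
    and finite_radon_measure_sing_part: "finite_radon_measure U (sing_part U \<mu>)"
    and lebesgue_singular_sing_part: "lebesgue_singular U (total_variation U (sing_part U \<mu>))"
proof -
  have "set_integrable lborel U (ac_part U \<mu>) \<and> finite_radon_measure U (sing_part U \<mu>) \<and>
     lebesgue_singular U (total_variation U (sing_part U \<mu>))"
    unfolding sing_part_def ac_part_def by (rule someI_ex[OF ac_part_exists[OF assms]])
  then show "set_integrable lborel U (ac_part U \<mu>)" "finite_radon_measure U (sing_part U \<mu>)"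
      "lebesgue_singular U (total_variation U (sing_part U \<mu>))"
    by blast+
qed

section \<open>Mollification and homogeneous integrands\<close>

text \<open>The cut-off falls linearly with the distance to \<open>K\<close>, at slope
  \<open>1 / d\<close>, where \<open>d\<close> is a positive lower bound for the distance from
  \<open>K\<close> to the complement of \<open>W\<close>. Being Lipschitz, it is uniformly
  continuous.\<close>

lemma continuous_separation:
  fixes K W :: "'a::euclidean_space set"
  assumes "compact K" "open W" "K \<subseteq> W"
  obtains \<psi> :: "'a \<Rightarrow> real" where "uniformly_continuous_on UNIV \<psi>"
    "\<And>x. 0 \<le> \<psi> x" "\<And>x. \<psi> x \<le> 1" "\<And>x. x \<in> K \<Longrightarrow> \<psi> x = 1" "\<And>x. x \<notin> W \<Longrightarrow> \<psi> x = 0"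
\<comment> \<open>\<open>infdist\<close> to the empty set is 0 by convention, so the formula below
  would give the constant 1 here.\<close>
proof (cases "K = {}")
  case True
  have "uniformly_continuous_on UNIV (\<lambda>x::'a. 0::real)" by (rule uniformly_continuous_on_const)
  then show thesis using that[of "\<lambda>x. 0"] True by simp
next
  case False
  obtain d where d: "0 < d" "\<And>x y. x \<in> K \<Longrightarrow> y \<in> - W \<Longrightarrow> d \<le> dist x y"
    using separate_compact_closed[of K "- W"] assms closed_Compl[OF assms(2)] by blast
  define \<psi> where "\<psi> x = max 0 (1 - infdist x K / d)" for x
  have "\<bar>\<psi> x - \<psi> y\<bar> \<le> dist x y / d" for x y
  proof -
    have "\<bar>\<psi> x - \<psi> y\<bar> \<le> \<bar>infdist x K / d - infdist y K / d\<bar>" unfolding \<psi>_def by linarith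
    also have "\<dots> = \<bar>infdist x K - infdist y K\<bar> / d" using d by (simp flip: diff_divide_distrib)
    also have "\<dots> \<le> dist x y / d"
      using d infdist_triangle_abs[of x K y] by (intro divide_right_mono) auto
    finally show ?thesis .
  qed
  then have "dist (\<psi> y) (\<psi> x) < e" if "dist y x < e * d" for x y e
    using le_less_trans[of "\<bar>\<psi> y - \<psi> x\<bar>" "dist y x / d" e] that d by (simp add: dist_real_def divide_less_eq)
  then have "uniformly_continuous_on UNIV \<psi>"
    unfolding uniformly_continuous_on_def using d by (meson mult_pos_pos)
  moreover have "\<psi> x = 0" if "x \<notin> W" for x
  proof -
    have "d \<le> infdist x K"
      unfolding infdist_notempty[OF False] using that d False
      by (intro cINF_greatest) (auto simp: dist_commute)
    then show ?thesis using d by (simp add: \<psi>_def)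
  qed
  ultimately show thesis
    using that[of \<psi>] d by (simp add: \<psi>_def infdist_nonneg)
qed

text \<open>Inner and outer regularity reduce indicators to the cut-offs above; sums and limits
  follow. Uniform continuity matters because the modulus of continuity will be used at all centres
  \<open>x\<close> at once.\<close>

lemma uniformly_continuous_dense_L1:
  fixes M :: "'a::euclidean_space measure" and u :: "'a \<Rightarrow> 'c::euclidean_space"
  assumes sM: "sets M = sets borel" and "finite_measure M" and u: "integrable M u" and e: "0 < e"
  shows "\<exists>v. uniformly_continuous_on UNIV v \<and> integrable M v \<and> (LINT x|M. norm (u x - v x)) < e"
  using u e
proof (induction arbitrary: e rule: integrable_induct)
  interpret finite_measure M by fact
  {
    case (base A c)
    \<comment> \<open>Inner and outer approximation cost \<open>\<delta>\<close> each, hence the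
      factor 2; adding 1 keeps the denominator positive when \<open>c = 0\<close>.\<close>
    define \<delta> where "\<delta> = e / (2 * (norm c + 1))"
    have \<delta>: "0 < \<delta>" "2 * \<delta> * norm c < e"
      using base.prems by (auto simp: \<delta>_def field_simps add_pos_nonneg)
    have A: "A \<in> sets borel" using base sM by simp
    have fin: "emeasure M (space M) \<noteq> \<infinity>" "emeasure M A \<noteq> \<infinity>" by auto
    have "{K. K \<subseteq> A \<and> compact K} \<noteq> {}" using compact_empty by blast
    from SUP_approx_ennreal[OF \<delta>(1) this inner_regular[OF sM fin(1) A] fin(2)]
    obtain K where K: "K \<subseteq> A" "compact K" "emeasure M A < emeasure M K + ennreal \<delta>"
      by (elim bexE CollectE conjE) (rule that)
    from INF_approx_ennreal[OF \<delta>(1) outer_regular[OF sM fin(1) A] fin(2)]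
    obtain W where W: "A \<subseteq> W" "open W" "emeasure M W < emeasure M A + ennreal \<delta>"
      by (elim bexE CollectE conjE) (rule that)
    have [measurable]: "K \<in> sets M" "W \<in> sets M" "A \<in> sets M"
      using K W sM A by (auto intro: borel_compact borel_open)
    have "measure M A < measure M K + \<delta>" "measure M W < measure M A + \<delta>"
      using K(3) W(3) \<delta>(1)
      by (simp_all add: emeasure_eq_measure ennreal_less_iff flip: ennreal_plus)
    moreover have "measure M (W - K) = measure M W - measure M K"
      using K W by (intro finite_measure_Diff) auto
    ultimately have WK: "measure M (W - K) < 2 * \<delta>" by simp
    obtain \<psi> :: "'a \<Rightarrow> real" where \<psi>: "uniformly_continuous_on UNIV \<psi>" "\<And>x. 0 \<le> \<psi> x" "\<And>x. \<psi> x \<le> 1"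
        "\<And>x. x \<in> K \<Longrightarrow> \<psi> x = 1" "\<And>x. x \<notin> W \<Longrightarrow> \<psi> x = 0"
      using continuous_separation[of K W] K W by blast
    have "\<psi> \<in> borel_measurable borel"
      using \<psi>(1) by (intro borel_measurable_continuous_onI uniformly_continuous_imp_continuous)
    then have [measurable]: "\<psi> \<in> borel_measurable M" by (simp add: measurable_cong_sets[OF sM refl])
    have ivc: "integrable M (\<lambda>x. \<psi> x *\<^sub>R c)"
      by (rule integrable_const_bound[where B = "norm c"]) (auto simp: \<psi> intro!: mult_left_le_one_le)
    have "uniformly_continuous_on UNIV (\<lambda>x. \<psi> x *\<^sub>R c)"
      by (rule bounded_linear.uniformly_continuous_on[OF bounded_linear_scaleR_left \<psi>(1)])
    moreover have "(LINT x|M. norm (indicator A x *\<^sub>R c - \<psi> x *\<^sub>R c)) < e"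
    proof -
      have "norm (indicator A x *\<^sub>R c - \<psi> x *\<^sub>R c) \<le> indicator (W - K) x * norm c" for x
      proof -
        \<comment> \<open>Both functions are 1 on \<open>K\<close> and 0 off \<open>W\<close>; in
          between both lie in the unit interval.\<close>
        have "\<bar>indicator A x - \<psi> x\<bar> \<le> (indicator (W - K) x :: real)"
          using \<psi>(2,3)[of x] \<psi>(4,5)[of x] K(1) W(1) by (auto simp: indicator_def)
        then show ?thesis
          by (simp flip: scaleR_diff_left add: mult_right_mono)
      qed
      then have "(LINT x|M. norm (indicator A x *\<^sub>R c - \<psi> x *\<^sub>R c)) \<le> (LINT x|M. indicator (W - K) x * norm c)"
        by (intro integral_mono integrable_norm Bochner_Integration.integrable_diff ivc
             integrable_mult_left integrable_scaleR_left integrable_real_indicator)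
           (auto simp: less_top[symmetric])
      also have "\<dots> = measure M (W - K) * norm c" by simp
      also have "\<dots> \<le> 2 * \<delta> * norm c" using WK by (intro mult_right_mono) auto
      finally show ?thesis using \<delta> by simp
    qed
    ultimately show ?case using ivc by blast
  next
    case (add f g)
    then obtain v w where v: "uniformly_continuous_on UNIV v" "integrable M v" "(LINT x|M. norm (f x - v x)) < e / 2"
      and w: "uniformly_continuous_on UNIV w" "integrable M w" "(LINT x|M. norm (g x - w x)) < e / 2"
      by (meson half_gt_zero)
    have "(LINT x|M. norm (f x + g x - (v x + w x))) \<le> (LINT x|M. norm (f x - v x) + norm (g x - w x))"
      using add v w by (intro integral_mono) (auto simp: add_diff_add intro!: norm_triangle_ineq)
    also have "\<dots> < e" using add v w by simp
    finally show ?case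
      using v w by (intro exI[of _ "\<lambda>x. v x + w x"]) (auto intro!: uniformly_continuous_on_add)
  next
    case (lim f s)
    have "(\<lambda>i. LINT x|M. norm (f x - s i x)) \<longlonglongrightarrow> (LINT x|M. 0)"
    \<comment> \<open>The induction rule provides \<open>norm (s i x) \<le> 2 * norm (f x)\<close>,
      so the difference is at most three times \<open>norm (f x)\<close>.\<close>
    proof (rule integral_dominated_convergence[where w = "\<lambda>x. 3 * norm (f x)"])
      show "AE x in M. (\<lambda>i. norm (f x - s i x)) \<longlonglongrightarrow> 0"
      proof (rule AE_I2)
        fix x assume "x \<in> space M"
        from tendsto_norm[OF tendsto_diff[OF tendsto_const lim.hyps(2)[OF this]], of "f x"]
        show "(\<lambda>i. norm (f x - s i x)) \<longlonglongrightarrow> 0" by simp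
      qed
      show "AE x in M. norm (norm (f x - s i x)) \<le> 3 * norm (f x)" for i
      proof (rule AE_I2)
        fix x assume "x \<in> space M"
        then show "norm (norm (f x - s i x)) \<le> 3 * norm (f x)"
          using lim.hyps(3)[of x i] norm_triangle_ineq4[of "f x" "s i x"] by simp
      qed
    qed (use lim in auto)
    then have "\<forall>\<^sub>F i in sequentially. (LINT x|M. norm (f x - s i x)) < e / 2"
      using lim.prems by (intro order_tendstoD(2)) auto
    then obtain i where i: "(LINT x|M. norm (f x - s i x)) < e / 2" by (auto simp: eventually_sequentially)
    obtain v where v: "uniformly_continuous_on UNIV v" "integrable M v" "(LINT x|M. norm (s i x - v x)) < e / 2"
      using lim.IH[of "e/2" i] lim.prems by auto
    have "(LINT x|M. norm (f x - v x)) \<le> (LINT x|M. norm (f x - s i x) + norm (s i x - v x))"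
    proof (intro integral_mono)
      show "norm (f x - v x) \<le> norm (f x - s i x) + norm (s i x - v x)" for x
        using norm_triangle_ineq[of "f x - s i x" "s i x - v x"] by simp
    qed (use lim v in auto)
    also have "\<dots> < e" using lim v i by simp
    finally show ?case using v by blast
  }
qed

text \<open>The sign of \<open>c\<close> is left free so that one change of variables covers both
  the dilation in \<open>x\<close> and the reflection in \<open>y\<close> of the kernel.\<close>

lemma lborel_integral_affine:
  fixes f :: "'a::euclidean_space \<Rightarrow> real" and t :: 'a
  assumes [measurable]: "f \<in> borel_measurable borel" and c: "c \<noteq> 0"
  shows "(LINT x|lborel. f x) = (LINT x|lborel. \<bar>c\<bar> ^ DIM('a) * f (t + c *\<^sub>R x))"
  by (subst lborel_affine[OF c, of t], subst integral_density)
     (auto simp: integral_distr ennreal_power)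

lemma lipschitz_nonneg_measurable:
  fixes G :: "'c::euclidean_space \<Rightarrow> real"
  assumes lip: "\<And>p q. \<bar>G p - G q\<bar> \<le> L * norm (p - q)"
  shows "0 \<le> L" "G \<in> borel_measurable borel"
proof -
  \<comment> \<open>Comparing a unit basis vector with 0 forces the sign; a Euclidean space always
    has such a vector.\<close>
  show "0 \<le> L"
    using order_trans[OF abs_ge_zero lip[of "SOME b. b \<in> Basis" 0]] some_in_eq[of "Basis::'c set"]
    by (simp add: norm_Basis)
  then have "continuous_on UNIV G"
    by (intro lipschitz_on_continuous_on[of L]) (auto simp: lipschitz_on_def dist_norm lip)
  then show "G \<in> borel_measurable borel" by (rule borel_measurable_continuous_onI)
qed

lemma integrable_lipschitz_comp:
  fixes G :: "'c::euclidean_space \<Rightarrow> real"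
  assumes f: "integrable N f" and lip: "\<And>p q. \<bar>G p - G q\<bar> \<le> L * norm (p - q)" and "G 0 = 0"
  shows "integrable N (\<lambda>x. G (f x))"
proof (rule Bochner_Integration.integrable_bound)
  show "integrable N (\<lambda>x. L * norm (f x))" using f by simp
  show "(\<lambda>x. G (f x)) \<in> borel_measurable N"
    using f lipschitz_nonneg_measurable(2)[OF lip] by (auto intro: measurable_compose)
  show "AE x in N. norm (G (f x)) \<le> norm (L * norm (f x))"
    using lip[of _ 0] lipschitz_nonneg_measurable(1)[OF lip] \<open>G 0 = 0\<close> by (auto simp: abs_mult)
qed

section \<open>The rescaled kernel\<close>

locale bump =
  fixes \<phi> :: "'a::euclidean_space \<Rightarrow> real"
  assumes cont: "continuous_on UNIV \<phi>"
    and nonneg: "\<And>x. 0 \<le> \<phi> x"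
    and supp: "\<And>x. 1 \<le> norm x \<Longrightarrow> \<phi> x = 0"
    and int: "(LINT x|lborel. \<phi> x) = 1"
begin

lemma measurable_bump [measurable]: "\<phi> \<in> borel_measurable borel"
  using cont by (rule borel_measurable_continuous_onI)

lemma measurable_rescale [measurable]: "rescale \<phi> \<epsilon> \<in> borel_measurable borel"
  unfolding rescale_def by measurable

lemma rescale_nonneg: "0 < \<epsilon> \<Longrightarrow> 0 \<le> rescale \<phi> \<epsilon> x"
  using nonneg by (simp add: rescale_def)

lemma rescale_eq_0: "0 < \<epsilon> \<Longrightarrow> \<epsilon> \<le> norm x \<Longrightarrow> rescale \<phi> \<epsilon> x = 0"
  by (simp add: rescale_def supp field_simps)

lemma rescale_bounded:
  assumes "0 < \<epsilon>"
  obtains B where "\<And>x. rescale \<phi> \<epsilon> x \<le> B"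
proof -
  have "bounded (\<phi> ` cball 0 1)"
    using cont by (intro compact_imp_bounded compact_continuous_image continuous_on_subset[OF cont]) auto
  then obtain B where B: "\<And>x. x \<in> cball 0 1 \<Longrightarrow> norm (\<phi> x) \<le> B"
    unfolding bounded_iff by blast
  have "\<phi> x \<le> max B 0" for x
    using B[of x] supp[of x] by (cases "norm x \<le> 1") auto
  then have "rescale \<phi> \<epsilon> x \<le> max B 0 / \<epsilon> ^ DIM('a)" for x
    using assms by (auto simp: rescale_def intro!: divide_right_mono)
  then show thesis by (rule that)
qed

lemma integral_rescale:
  assumes \<epsilon>: "0 < \<epsilon>"
  shows "(LINT x|lborel. rescale \<phi> \<epsilon> (x - y)) = 1" "(LINT y|lborel. rescale \<phi> \<epsilon> (x - y)) = 1"
proof -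
  have "(LINT x|lborel. rescale \<phi> \<epsilon> (x - y)) = (LINT x|lborel. \<phi> x)"
    using \<epsilon> by (subst lborel_integral_affine[where c = \<epsilon> and t = y]) (auto simp: rescale_def)
  then show "(LINT x|lborel. rescale \<phi> \<epsilon> (x - y)) = 1" using int by simp
  \<comment> \<open>In the variable \<open>y\<close> the kernel is reflected, hence the scale
    \<open>- \<epsilon>\<close>; \<open>\<phi>\<close> need not be even.\<close>
  have "(LINT y|lborel. rescale \<phi> \<epsilon> (x - y)) = (LINT x|lborel. \<phi> x)"
    using \<epsilon> by (subst lborel_integral_affine[where c = "- \<epsilon>" and t = x]) (auto simp: rescale_def)
  then show "(LINT y|lborel. rescale \<phi> \<epsilon> (x - y)) = 1" using int by simp
qed

text \<open>A function that is not integrable has integral 0 by convention, whereas this integral is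
  1.\<close>

lemma integrable_rescale:
  assumes "0 < \<epsilon>"
  shows "integrable lborel (\<lambda>x. rescale \<phi> \<epsilon> (x - y))"
  using integral_rescale(1)[OF assms, of y] not_integrable_integral_eq by fastforce

lemma set_integral_rescale_bounds:
  assumes \<epsilon>: "0 < \<epsilon>" and A: "A \<in> sets borel"
  shows "0 \<le> (LINT x:A|lborel. rescale \<phi> \<epsilon> (x - y))"
    and "(LINT x:A|lborel. rescale \<phi> \<epsilon> (x - y)) \<le> 1"
proof -
  show "0 \<le> (LINT x:A|lborel. rescale \<phi> \<epsilon> (x - y))"
    unfolding set_lebesgue_integral_def using rescale_nonneg[OF \<epsilon>] by simp
  have "(LINT x:A|lborel. rescale \<phi> \<epsilon> (x - y)) \<le> (LINT x|lborel. rescale \<phi> \<epsilon> (x - y))"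
    unfolding set_lebesgue_integral_def using integrable_rescale[OF \<epsilon>] rescale_nonneg[OF \<epsilon>] A
      integrable_mult_indicator[OF _ integrable_rescale[OF \<epsilon>], of A y]
    by (intro integral_mono) (auto simp: indicator_def)
  then show "(LINT x:A|lborel. rescale \<phi> \<epsilon> (x - y)) \<le> 1" using integral_rescale(1)[OF \<epsilon>] by simp
qed

end

section \<open>Mollification of measures with a density over a finite Borel measure\<close>

locale bump_measure = bump \<phi> + finite_measure M for \<phi> :: "'a::euclidean_space \<Rightarrow> real" and M :: "'a measure" +
  assumes sets_M [measurable_cong]: "sets M = sets borel"
begin

lemma space_M: "space M = UNIV"
  using sets_eq_imp_space_eq[OF sets_M] by simp

text \<open>The mollification of the vector measure with density \<open>u\<close> over
  \<open>M\<close>, not of the function \<open>u\<close>: the result is a Lebesgue density.\<close>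

definition conv :: "('a \<Rightarrow> 'c::euclidean_space) \<Rightarrow> real \<Rightarrow> 'a \<Rightarrow> 'c"
  where "conv u \<epsilon> x = (LINT y|M. rescale \<phi> \<epsilon> (x - y) *\<^sub>R u y)"

lemma integrable_conv:
  fixes u :: "'a \<Rightarrow> 'c::euclidean_space"
  assumes "0 < \<epsilon>" "integrable M u"
  shows "integrable M (\<lambda>y. rescale \<phi> \<epsilon> (x - y) *\<^sub>R u y)"
proof -
  obtain B where B: "\<And>x. rescale \<phi> \<epsilon> x \<le> B" using rescale_bounded assms by blast
  show ?thesis
    by (rule integrable_bounded_scaleR[OF assms(2), where B = B])
       (use B rescale_nonneg[OF assms(1)] in \<open>auto simp: abs_of_nonneg\<close>)
qed

text \<open>Fubini moves the mollification from the measure to the indicator of \<open>A\<close>,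
  leaving a weight between 0 and 1. With \<open>A = UNIV\<close> the weight is 1 and mass is
  preserved.\<close>

lemma integral_conv:
  fixes u :: "'a \<Rightarrow> 'c::euclidean_space"
  assumes \<epsilon>: "0 < \<epsilon>" and u: "integrable M u" and A: "A \<in> sets borel"
  shows "integrable lborel (\<lambda>x. indicator A x *\<^sub>R conv u \<epsilon> x)"
    and "(LINT x:A|lborel. conv u \<epsilon> x) = (LINT y|M. (LINT x:A|lborel. rescale \<phi> \<epsilon> (x - y)) *\<^sub>R u y)"
proof -
  interpret P: pair_sigma_finite M lborel
    by (simp add: pair_sigma_finite_def sigma_finite_measure_axioms lborel.sigma_finite_measure_axioms)
  have [measurable]: "u \<in> borel_measurable M" using u by auto
  have [measurable]: "A \<in> sets borel" by fact
  let ?f = "\<lambda>y x. (indicator A x * rescale \<phi> \<epsilon> (x - y)) *\<^sub>R u y"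
  let ?K = "\<lambda>y. LINT x:A|lborel. rescale \<phi> \<epsilon> (x - y)"
  have iA: "integrable lborel (\<lambda>x. indicator A x * rescale \<phi> \<epsilon> (x - y))" for y
    using integrable_mult_indicator[OF _ integrable_rescale[OF \<epsilon>], of A y] A by simp
  have K: "0 \<le> ?K y" "?K y \<le> 1" for y
    using set_integral_rescale_bounds[OF \<epsilon> A] by auto
  have [measurable]: "?K \<in> borel_measurable M"
    unfolding set_lebesgue_integral_def by measurable
  have int: "integrable (M \<Otimes>\<^sub>M lborel) (case_prod ?f)"
  proof (rule P.Fubini_integrable)
    show "(\<lambda>(y, x). ?f y x) \<in> borel_measurable (M \<Otimes>\<^sub>M lborel)" by measurable
    have "(LINT x|lborel. norm (case (y, x) of (y, x) \<Rightarrow> ?f y x)) = ?K y *\<^sub>R norm (u y)" for y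
      using rescale_nonneg[OF \<epsilon>] by (simp add: set_lebesgue_integral_def abs_mult)
    moreover have "integrable M (\<lambda>y. ?K y *\<^sub>R norm (u y))"
      using u K by (intro integrable_bounded_scaleR[where B = 1]) auto
    ultimately show "integrable M (\<lambda>y. LINT x|lborel. norm (case (y, x) of (y, x) \<Rightarrow> ?f y x))"
      by (simp only:)
    show "AE y in M. integrable lborel (\<lambda>x. case (y, x) of (y, x) \<Rightarrow> ?f y x)"
      using iA by simp
  qed
  have eq: "(LINT y|M. ?f y x) = indicator A x *\<^sub>R conv u \<epsilon> x" for x
    by (simp add: conv_def flip: scaleR_scaleR)
  show "integrable lborel (\<lambda>x. indicator A x *\<^sub>R conv u \<epsilon> x)"
    using P.integrable_snd[OF int] by (simp add: eq)
  show "(LINT x:A|lborel. conv u \<epsilon> x) = (LINT y|M. ?K y *\<^sub>R u y)"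
    using P.Fubini_integral[OF int] iA by (simp add: eq set_lebesgue_integral_def)
qed

text \<open>The mollified indicator of \<open>A\<close> equals the indicator at every point off the
  frontier once \<open>\<epsilon>\<close> is small. The frontier is null for \<open>M\<close>, and
  \<open>norm (u y)\<close> dominates.\<close>

lemma conv_tendsto:
  fixes u :: "'a \<Rightarrow> 'c::euclidean_space"
  assumes u: "integrable M u" and A: "A \<in> sets borel" and fr: "emeasure M (frontier A) = 0"
  shows "((\<lambda>\<epsilon>. LINT x:A|lborel. conv u \<epsilon> x) \<longlongrightarrow> (LINT x:A|M. u x)) (at_right 0)"
  unfolding tendsto_at_iff_sequentially comp_def
proof (intro allI impI)
  fix X :: "nat \<Rightarrow> real" assume "\<forall>i. X i \<in> {0<..} - {0}" and X: "X \<longlonglongrightarrow> 0"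
  then have X0: "0 < X i" for i by auto
  have [measurable]: "u \<in> borel_measurable M" "A \<in> sets borel" using u A by auto
  let ?K = "\<lambda>\<epsilon> y. LINT x:A|lborel. rescale \<phi> \<epsilon> (x - y)"
  have K: "0 \<le> ?K \<epsilon> y" "?K \<epsilon> y \<le> 1" if "0 < \<epsilon>" for y \<epsilon>
    using set_integral_rescale_bounds[OF that A] by auto
  have "(\<lambda>i. LINT y|M. ?K (X i) y *\<^sub>R u y) \<longlonglongrightarrow> (LINT y|M. indicator A y *\<^sub>R u y)"
  proof (rule integral_dominated_convergence[where w = "\<lambda>y. norm (u y)"])
    show "(\<lambda>y. ?K (X i) y *\<^sub>R u y) \<in> borel_measurable M" for i
      unfolding set_lebesgue_integral_def by measurable
    show "AE y in M. norm (?K (X i) y *\<^sub>R u y) \<le> norm (u y)" for i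
      using K[OF X0, of i] by (auto simp: mult_left_le_one_le)
    have "frontier A \<in> null_sets M" using fr by (auto simp: null_sets_def sets_M frontier_closed borel_closed)
    then have "AE y in M. y \<notin> frontier A" by (rule AE_not_in)
    then show "AE y in M. (\<lambda>i. ?K (X i) y *\<^sub>R u y) \<longlonglongrightarrow> indicator A y *\<^sub>R u y"
    proof eventually_elim
      case (elim y)
      then consider "y \<in> interior A" | "y \<in> - closure A"
        by (auto simp: frontier_def)
      then have "\<forall>\<^sub>F i in sequentially. ?K (X i) y = indicator A y"
      proof cases
        case 1
        then obtain e where e: "0 < e" "ball y e \<subseteq> A" by (meson mem_interior)
        have "?K \<epsilon> y = 1" if "0 < \<epsilon>" "\<epsilon> < e" for \<epsilon>
        proof -
          have "indicator A x *\<^sub>R rescale \<phi> \<epsilon> (x - y) = rescale \<phi> \<epsilon> (x - y)" for x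
            using e that rescale_eq_0[of \<epsilon> "x - y"]
            by (cases "x \<in> A"; cases "\<epsilon> \<le> norm (x - y)") (auto simp: subset_iff dist_norm norm_minus_commute)
          then show ?thesis
            by (simp only: set_lebesgue_integral_def integral_rescale(1)[OF that(1)])
        qed
        moreover have "\<forall>\<^sub>F i in sequentially. X i < e" using X e(1) by (rule order_tendstoD)
        moreover have "y \<in> A" using 1 interior_subset by blast
        ultimately show ?thesis using X0 by (auto elim!: eventually_mono)
      next
        case 2
        then obtain e where e: "0 < e" "ball y e \<subseteq> - closure A"
          by (meson open_contains_ball open_Compl closed_closure)
        have "?K \<epsilon> y = 0" if "0 < \<epsilon>" "\<epsilon> < e" for \<epsilon>
        proof -
          have "indicator A x *\<^sub>R rescale \<phi> \<epsilon> (x - y) = 0" for x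
            using e that rescale_eq_0[of \<epsilon> "x - y"] closure_subset[of A]
            by (cases "x \<in> A"; cases "\<epsilon> \<le> norm (x - y)") (auto simp: subset_iff dist_norm norm_minus_commute)
          then show ?thesis
            by (simp only: set_lebesgue_integral_def Bochner_Integration.integral_zero)
        qed
        moreover have "\<forall>\<^sub>F i in sequentially. X i < e" using X e(1) by (rule order_tendstoD)
        moreover have "y \<notin> A" using 2 closure_subset by blast
        ultimately show ?thesis using X0 by (auto elim!: eventually_mono)
      qed
      then show ?case
        by (intro tendsto_scaleR tendsto_const) (rule tendsto_eventually)
    qed
  qed (use u in auto)
  then show "(\<lambda>i. LINT x:A|lborel. conv u (X i) x) \<longlonglongrightarrow> (LINT x:A|M. u x)"
    by (simp add: integral_conv(2)[OF X0 u A] set_lebesgue_integral_def[of M])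
qed

text \<open>Both terms are compared with the one obtained by freezing \<open>u\<close> at the
  constant \<open>c = v x\<close>. Each comparison costs \<open>L\<close> times the kernel average
  of \<open>norm (u y - c)\<close>, whence the factor 2, and on the support of the kernel that norm
  is at most \<open>norm (u y - v y) + \<omega>\<close>.\<close>

lemma commutator_bound:
  fixes u v :: "'a \<Rightarrow> 'c::euclidean_space" and G :: "'c \<Rightarrow> real"
  assumes \<epsilon>: "0 < \<epsilon>" and u: "integrable M u" and v: "integrable M v"
    and lip: "\<And>p q. \<bar>G p - G q\<bar> \<le> L * norm (p - q)"
    and hom: "\<And>r p. 0 \<le> r \<Longrightarrow> G (r *\<^sub>R p) = r * G p"
    and \<omega>: "\<And>x y. dist x y < \<epsilon> \<Longrightarrow> norm (v x - v y) \<le> \<omega>"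
  shows "\<bar>G (conv u \<epsilon> x) - conv (\<lambda>y. G (u y)) \<epsilon> x\<bar> \<le> 2 * L * conv (\<lambda>y. norm (u y - v y) + \<omega>) \<epsilon> x"
proof -
  note L0 = lipschitz_nonneg_measurable(1)[OF lip]
  define k where "k y = rescale \<phi> \<epsilon> (x - y)" for y
  define c where "c = v x"
  have k0: "0 \<le> k y" for y unfolding k_def by (rule rescale_nonneg[OF \<epsilon>])
  have [measurable]: "k \<in> borel_measurable M" unfolding k_def by measurable
  have [measurable]: "u \<in> borel_measurable M" "v \<in> borel_measurable M" using u v by auto
  have G0: "G 0 = 0" using hom[of 0 0] by simp
  have iGu: "integrable M (\<lambda>y. G (u y))"
    by (rule integrable_lipschitz_comp[OF u lip G0])
  have ik: "integrable M (\<lambda>y. k y *\<^sub>R w y)" if "integrable M w" for w :: "'a \<Rightarrow> 'd::euclidean_space"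
    unfolding k_def using that by (rule integrable_conv[OF \<epsilon>])
  have ic: "integrable M (\<lambda>y. c)" by simp
  have inorm: "integrable M (\<lambda>y. k y *\<^sub>R norm (u y - c))" using u by (intro ik) simp
  have "\<bar>G (conv u \<epsilon> x) - G (LINT y|M. k y *\<^sub>R c)\<bar> \<le> L * norm (LINT y|M. k y *\<^sub>R (u y - c))"
    using lip[of "conv u \<epsilon> x" "LINT y|M. k y *\<^sub>R c"] ik[OF u] ik[OF ic]
    by (simp add: conv_def k_def[symmetric] scaleR_diff_right)
  also have "\<dots> \<le> L * (LINT y|M. k y *\<^sub>R norm (u y - c))"
    using integral_norm_bound[of M "\<lambda>y. k y *\<^sub>R (u y - c)"] k0 L0 by (intro mult_left_mono) simp_all
  finally have 1: "\<bar>G (conv u \<epsilon> x) - G (LINT y|M. k y *\<^sub>R c)\<bar> \<le> L * (LINT y|M. k y *\<^sub>R norm (u y - c))" .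
  have "(LINT y|M. k y *\<^sub>R c) = (LINT y|M. k y) *\<^sub>R c"
    using ik[of "\<lambda>_. 1::real"] by simp
  \<comment> \<open>Homogeneity is applied with \<open>r\<close> the kernel mass under
    \<open>M\<close>, an arbitrary nonnegative number.\<close>
  then have Gc: "G (LINT y|M. k y *\<^sub>R c) = (LINT y|M. k y *\<^sub>R G c)"
    using ik[of "\<lambda>_. 1::real"] k0 by (simp add: hom)
  have "\<bar>(LINT y|M. k y *\<^sub>R G c) - conv (\<lambda>y. G (u y)) \<epsilon> x\<bar> = \<bar>LINT y|M. k y *\<^sub>R (G c - G (u y))\<bar>"
    using ik[OF iGu] ik[of "\<lambda>_. G c"] by (simp add: conv_def k_def[symmetric] right_diff_distrib)
  also have "\<dots> \<le> (LINT y|M. \<bar>k y *\<^sub>R (G c - G (u y))\<bar>)"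
    by (rule integral_abs_bound)
  also have "\<dots> \<le> (LINT y|M. L * (k y *\<^sub>R norm (u y - c)))"
  proof (rule integral_mono)
    show "integrable M (\<lambda>y. \<bar>k y *\<^sub>R (G c - G (u y))\<bar>)"
      using ik[of "\<lambda>y. G c - G (u y)"] iGu by (intro integrable_abs) simp
    show "integrable M (\<lambda>y. L * (k y *\<^sub>R norm (u y - c)))" using inorm by simp
    show "\<bar>k y *\<^sub>R (G c - G (u y))\<bar> \<le> L * (k y *\<^sub>R norm (u y - c))" for y
      using mult_left_mono[OF lip[of c "u y"] k0[of y]] k0[of y]
      by (simp add: abs_mult norm_minus_commute mult.left_commute)
  qed
  finally have 2: "\<bar>(LINT y|M. k y *\<^sub>R G c) - conv (\<lambda>y. G (u y)) \<epsilon> x\<bar> \<le> L * (LINT y|M. k y *\<^sub>R norm (u y - c))"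
    by simp
  have "(LINT y|M. k y *\<^sub>R norm (u y - c)) \<le> (LINT y|M. k y *\<^sub>R (norm (u y - v y) + \<omega>))"
  proof (rule integral_mono[OF inorm])
    show "integrable M (\<lambda>y. k y *\<^sub>R (norm (u y - v y) + \<omega>))" using u v by (intro ik) simp
    show "k y *\<^sub>R norm (u y - c) \<le> k y *\<^sub>R (norm (u y - v y) + \<omega>)" for y
    proof (cases "dist x y < \<epsilon>")
      case True
      then have "norm (u y - c) \<le> norm (u y - v y) + \<omega>"
        using \<omega>[of y x] norm_triangle_ineq[of "u y - v y" "v y - c"] by (simp add: c_def dist_commute)
      then show ?thesis using k0[of y] by (simp add: mult_left_mono)
    next
      case False
      then have "k y = 0" unfolding k_def using \<epsilon> by (intro rescale_eq_0) (auto simp: dist_norm)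
      then show ?thesis by simp
    qed
  qed
  then have "L * (LINT y|M. k y *\<^sub>R norm (u y - c)) \<le> L * conv (\<lambda>y. norm (u y - v y) + \<omega>) \<epsilon> x"
    using L0 unfolding conv_def k_def by (intro mult_left_mono)
  with 1 2 Gc show ?thesis by linarith
qed

theorem reshetnyak_mollification:
  fixes u :: "'a \<Rightarrow> 'c::euclidean_space" and G :: "'c \<Rightarrow> real"
  assumes u: "integrable M u" and A: "A \<in> sets borel" and fr: "emeasure M (frontier A) = 0"
    and lip: "\<And>p q. \<bar>G p - G q\<bar> \<le> L * norm (p - q)"
    and hom: "\<And>r p. 0 \<le> r \<Longrightarrow> G (r *\<^sub>R p) = r * G p"
  shows "((\<lambda>\<epsilon>. LINT x:A|lborel. G (conv u \<epsilon> x)) \<longlongrightarrow> (LINT x:A|M. G (u x))) (at_right 0)"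
proof -
  note L0 = lipschitz_nonneg_measurable(1)[OF lip]
  have [measurable]: "u \<in> borel_measurable M" "A \<in> sets borel" using u A by auto
  have G0: "G 0 = 0" using hom[of 0 0] by simp
  have iGu: "integrable M (\<lambda>y. G (u y))"
    by (rule integrable_lipschitz_comp[OF u lip G0])
  have "((\<lambda>\<epsilon>. (LINT x:A|lborel. G (conv u \<epsilon> x)) - (LINT x:A|lborel. conv (\<lambda>y. G (u y)) \<epsilon> x)) \<longlongrightarrow> 0) (at_right 0)"
  proof (rule tendstoI)
    fix e :: real assume e: "0 < e"
    define m where "m = measure M UNIV"
    \<comment> \<open>The same \<open>\<eta>\<close> bounds the \<open>L1\<close> error and the
      oscillation; it solves \<open>2 * L * (\<eta> + \<eta> * m) + \<eta> = e\<close>, and the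
      spare \<open>\<eta>\<close> makes the final inequality strict.\<close>
    define \<eta> where "\<eta> = e / (2 * L * (1 + m) + 1)"
    have m0: "0 \<le> m" by (simp add: m_def)
    have den: "0 < 2 * L * (1 + m) + 1" using m0 L0 by (intro add_nonneg_pos) auto
    then have \<eta>: "0 < \<eta>" using e by (simp add: \<eta>_def)
    have "\<eta> * (2 * L * (1 + m) + 1) = e" using den by (simp add: \<eta>_def)
    then have "2 * L * (\<eta> + \<eta> * m) + \<eta> = e" by (simp add: algebra_simps)
    then have \<eta>e: "2 * L * (\<eta> + \<eta> * m) < e" using \<eta> by linarith
    obtain v where v: "uniformly_continuous_on UNIV v" "integrable M v" "(LINT x|M. norm (u x - v x)) < \<eta>"
      using uniformly_continuous_dense_L1[OF sets_M finite_measure_axioms u \<eta>] by blast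
    obtain d where d: "0 < d" "\<And>x y. dist x y < d \<Longrightarrow> norm (v x - v y) \<le> \<eta>"
      using v(1) \<eta> unfolding uniformly_continuous_on_def dist_norm[of "v _"] by (metis UNIV_I less_imp_le)
    have "dist ((LINT x:A|lborel. G (conv u \<epsilon> x)) - (LINT x:A|lborel. conv (\<lambda>y. G (u y)) \<epsilon> x)) 0 < e"
      if \<epsilon>: "0 < \<epsilon>" "\<epsilon> < d" for \<epsilon>
    proof -
      let ?h = "\<lambda>y. norm (u y - v y) + \<eta>"
      have ih: "integrable M ?h" using u v by simp
      note I1 = integral_conv(1)[OF \<epsilon>(1) u A] and I2 = integral_conv(1)[OF \<epsilon>(1) iGu A]
        and I3 = integral_conv(1)[OF \<epsilon>(1) ih, of UNIV, simplified]
      \<comment> \<open>Homogeneity with factors 0 and 1 puts the indicator inside \<open>G\<close>,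
        so integrability follows from the Lipschitz composition rule.\<close>
      have GA: "indicator A x *\<^sub>R G (conv u \<epsilon> x) = G (indicator A x *\<^sub>R conv u \<epsilon> x)" for x
        by (simp add: hom)
      have I1': "integrable lborel (\<lambda>x. indicator A x *\<^sub>R G (conv u \<epsilon> x))"
        unfolding GA by (rule integrable_lipschitz_comp[OF I1 lip G0])
      have "\<bar>(LINT x:A|lborel. G (conv u \<epsilon> x)) - (LINT x:A|lborel. conv (\<lambda>y. G (u y)) \<epsilon> x)\<bar>
          = \<bar>LINT x|lborel. indicator A x *\<^sub>R G (conv u \<epsilon> x) - indicator A x *\<^sub>R conv (\<lambda>y. G (u y)) \<epsilon> x\<bar>"
        unfolding set_lebesgue_integral_def using I1' I2 by simp
      also have "\<dots> \<le> (LINT x|lborel. \<bar>indicator A x *\<^sub>R G (conv u \<epsilon> x) - indicator A x *\<^sub>R conv (\<lambda>y. G (u y)) \<epsilon> x\<bar>)"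
        by (rule integral_abs_bound)
      also have "\<dots> \<le> (LINT x|lborel. 2 * L * conv ?h \<epsilon> x)"
      proof (rule integral_mono)
        show "integrable lborel (\<lambda>x. \<bar>indicator A x *\<^sub>R G (conv u \<epsilon> x) - indicator A x *\<^sub>R conv (\<lambda>y. G (u y)) \<epsilon> x\<bar>)"
          using I1' I2 by (intro integrable_abs Bochner_Integration.integrable_diff)
        show "integrable lborel (\<lambda>x. 2 * L * conv ?h \<epsilon> x)" using I3 by simp
        fix x
        have "\<bar>G (conv u \<epsilon> x) - conv (\<lambda>y. G (u y)) \<epsilon> x\<bar> \<le> 2 * L * conv ?h \<epsilon> x"
          by (rule commutator_bound[OF \<epsilon>(1) u v(2) lip hom]) (use d \<epsilon> in auto)
        then show "\<bar>indicator A x *\<^sub>R G (conv u \<epsilon> x) - indicator A x *\<^sub>R conv (\<lambda>y. G (u y)) \<epsilon> x\<bar>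
            \<le> 2 * L * conv ?h \<epsilon> x"
          by (auto simp: indicator_def)
      qed
      also have "\<dots> = 2 * L * (LINT y|M. ?h y)"
        using integral_conv(2)[OF \<epsilon>(1) ih, of UNIV] integral_rescale(1)[OF \<epsilon>(1)]
        by (simp add: set_lebesgue_integral_def)
      also have "\<dots> = 2 * L * ((LINT y|M. norm (u y - v y)) + \<eta> * m)"
        using u v by (simp add: m_def space_M)
      also have "\<dots> \<le> 2 * L * (\<eta> + \<eta> * m)"
        using v(3) L0 by (intro mult_left_mono) auto
      finally show ?thesis using \<eta>e by simp
    qed
    then show "\<forall>\<^sub>F \<epsilon> in at_right 0. dist ((LINT x:A|lborel. G (conv u \<epsilon> x)) - (LINT x:A|lborel. conv (\<lambda>y. G (u y)) \<epsilon> x)) 0 < e"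
      using d(1) unfolding eventually_at_right_field by blast
  qed
  from tendsto_add[OF this conv_tendsto[OF iGu A fr]] show ?thesis by simp
qed

end

section \<open>The perspective of an integrand of linear growth\<close>

lemma const_divide_tendsto_at_top: "((\<lambda>t::real. c / t) \<longlongrightarrow> (0::real)) at_top"
  by (rule real_tendsto_divide_at_top[OF tendsto_const filterlim_ident])

text \<open>Difference quotients of a convex function along a ray increase, and linear growth with
  \<open>0 \<le> g\<close> bounds their limit at infinity by \<open>C\<close>. Here \<open>q\<close>
  lies between \<open>p\<close> and the far point \<open>p + t e\<close>, and \<open>t\<close> tends
  to infinity.\<close>

lemma convex_linear_growth_imp_lipschitz:
  fixes g :: "'b::real_normed_vector \<Rightarrow> real"
  assumes cvx: "convex_on UNIV g" and g0: "\<And>p. 0 \<le> g p" and g1: "\<And>p. g p \<le> C * (1 + norm p)" and "0 \<le> C"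
  shows "\<bar>g p - g q\<bar> \<le> C * norm (p - q)"
proof -
  have "g q - g p \<le> C * norm (p - q)" for p q
  proof (cases "p = q")
    case False
    define r where "r = norm (q - p)"
    define e where "e = (q - p) /\<^sub>R r"
    have r: "0 < r" using False by (simp add: r_def)
    have e: "norm e = 1" using r by (simp add: e_def r_def)
    have bound: "g q - g p \<le> r * C + r * C * (1 + norm p) / t" if t: "r \<le> t" for t
    proof -
      have t0: "0 < t" using r t by simp
      have "q = (1 - r / t) *\<^sub>R p + (r / t) *\<^sub>R (p + t *\<^sub>R e)"
        using r t0 by (simp add: e_def algebra_simps)
      then have "g q \<le> (1 - r / t) * g p + (r / t) * g (p + t *\<^sub>R e)"
        using convex_onD[OF cvx, of "r / t" p "p + t *\<^sub>R e"] r t t0 by simp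
      then have "g q - g p \<le> (r / t) * (g (p + t *\<^sub>R e) - g p)" by (simp add: algebra_simps)
      also have "\<dots> \<le> (r / t) * (C * (1 + norm p + t))"
      proof (rule mult_left_mono)
        have "norm (p + t *\<^sub>R e) \<le> norm p + t" using norm_triangle_ineq[of p "t *\<^sub>R e"] e t0 by simp
        then have "C * (1 + norm (p + t *\<^sub>R e)) \<le> C * (1 + norm p + t)"
          using \<open>0 \<le> C\<close> by (intro mult_left_mono) auto
        then show "g (p + t *\<^sub>R e) - g p \<le> C * (1 + norm p + t)"
          using g1[of "p + t *\<^sub>R e"] g0[of p] by linarith
      qed (use r t0 in auto)
      also have "\<dots> = r * C + r * C * (1 + norm p) / t" using t0 by (simp add: field_simps)
      finally show ?thesis .
    qed
    have "((\<lambda>t. r * C + r * C * (1 + norm p) / t) \<longlongrightarrow> r * C + 0) at_top"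
      by (intro tendsto_add tendsto_const const_divide_tendsto_at_top)
    then have "g q - g p \<le> r * C + 0"
      by (rule tendsto_lowerbound) (auto simp: eventually_at_top_linorder intro: bound)
    then show ?thesis by (simp add: r_def norm_minus_commute mult.commute)
  qed simp
  from this[of p q] this[of q p] show ?thesis by (simp add: norm_minus_commute abs_le_iff)
qed

lemma recession_eqI:
  assumes "((\<lambda>t. g (t *\<^sub>R p) / t) \<longlongrightarrow> l) at_top"
  shows "recession g p = l"
proof -
  have "((\<lambda>t. ereal (g (t *\<^sub>R p) / t)) \<longlongrightarrow> ereal l) at_top" using assms by simp
  from lim_imp_Limsup[OF _ this] show ?thesis by (simp add: recession_def)
qed

text \<open>Substitution of \<open>r * t\<close> for \<open>t\<close>. It carries limits from the
  unit sphere to all nonzero vectors and yields homogeneity of the recession function.\<close>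

lemma recession_limit_scaleR:
  fixes g :: "'b::euclidean_space \<Rightarrow> real"
  assumes "((\<lambda>t. g (t *\<^sub>R p) / t) \<longlongrightarrow> l) at_top" and r: "0 < r"
  shows "((\<lambda>t. g (t *\<^sub>R (r *\<^sub>R p)) / t) \<longlongrightarrow> r * l) at_top"
proof -
  have "filterlim (\<lambda>t. r * t) at_top at_top"
    using r by (intro filterlim_tendsto_pos_mult_at_top[OF tendsto_const] filterlim_ident)
  from filterlim_compose[OF assms(1) this]
  have "((\<lambda>t. r * (g ((r * t) *\<^sub>R p) / (r * t))) \<longlongrightarrow> r * l) at_top"
    by (intro tendsto_mult tendsto_const)
  then show ?thesis using r by (simp add: mult.commute)
qed

text \<open>\<open>K\<close> is the constant of the rate, kept apart from the growth constant
  \<open>C\<close>.\<close>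

locale recession_integrand =
  fixes g :: "'b::euclidean_space \<Rightarrow> real" and C K \<alpha> :: real
  assumes cvx: "convex_on UNIV g" and g0: "\<And>p. 0 \<le> g p" and g1: "\<And>p. g p \<le> C * (1 + norm p)"
    and C: "0 < C" and K: "0 < K" and \<alpha>: "1 < \<alpha>"
    and rec: "\<And>p t. norm p = 1 \<Longrightarrow> 0 < t \<Longrightarrow> \<bar>g (t *\<^sub>R p) / t - recession g p\<bar> \<le> K / t powr \<alpha>"
begin

lemma g_lipschitz: "\<bar>g p - g q\<bar> \<le> C * norm (p - q)"
  using convex_linear_growth_imp_lipschitz[OF cvx g0 g1] C by simp

text \<open>The rate turns the upper limit into a true limit on the unit sphere; scaling gives the
  other nonzero vectors, and at 0 the quotient is \<open>g 0 / t\<close>.\<close>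

lemma recession_lim: "((\<lambda>t. g (t *\<^sub>R p) / t) \<longlongrightarrow> recession g p) at_top"
proof (cases "p = 0")
  case True
  then have "((\<lambda>t. g (t *\<^sub>R p) / t) \<longlongrightarrow> 0) at_top" by (simp add: const_divide_tendsto_at_top)
  then show ?thesis using recession_eqI by metis
next
  case False
  define e where "e = p /\<^sub>R norm p"
  have e: "norm e = 1" "p = norm p *\<^sub>R e" using False by (simp_all add: e_def)
  have "((\<lambda>t. K * t powr (- \<alpha>)) \<longlongrightarrow> K * 0) at_top"
    using \<alpha> by (intro tendsto_mult tendsto_const tendsto_neg_powr filterlim_ident) simp
  then have "((\<lambda>t. K / t powr \<alpha>) \<longlongrightarrow> 0) at_top" by (simp add: powr_minus_divide)
  then have "((\<lambda>t. g (t *\<^sub>R e) / t - recession g e) \<longlongrightarrow> 0) at_top"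
    by (rule Lim_null_comparison[rotated])
       (use rec[OF e(1)] in \<open>auto simp: eventually_at_top_dense intro!: exI[of _ 0]\<close>)
  then have "((\<lambda>t. g (t *\<^sub>R e) / t) \<longlongrightarrow> recession g e) at_top"
    by (rule LIM_zero_cancel)
  then have "((\<lambda>t. g (t *\<^sub>R (norm p *\<^sub>R e)) / t) \<longlongrightarrow> norm p * recession g e) at_top"
    using False by (intro recession_limit_scaleR) auto
  then have lim: "((\<lambda>t. g (t *\<^sub>R p) / t) \<longlongrightarrow> norm p * recession g e) at_top" by (simp only: e(2)[symmetric])
  then show ?thesis using recession_eqI[OF lim] by (simp only:)
qed

lemma recession_hom:
  assumes "0 \<le> r"
  shows "recession g (r *\<^sub>R p) = r * recession g p"
proof (cases "r = 0")
  case True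
  have "((\<lambda>t. g (t *\<^sub>R 0) / t) \<longlongrightarrow> 0) at_top" by (simp add: const_divide_tendsto_at_top)
  then show ?thesis using True by (simp add: recession_eqI)
next
  case False
  then show ?thesis using assms by (intro recession_eqI recession_limit_scaleR recession_lim) auto
qed

lemma recession_lipschitz: "\<bar>recession g p - recession g q\<bar> \<le> C * norm (p - q)"
proof (rule tendsto_upperbound)
  show "((\<lambda>t. \<bar>g (t *\<^sub>R p) / t - g (t *\<^sub>R q) / t\<bar>) \<longlongrightarrow> \<bar>recession g p - recession g q\<bar>) at_top"
    by (intro tendsto_rabs tendsto_diff recession_lim)
  have "\<bar>g (t *\<^sub>R p) / t - g (t *\<^sub>R q) / t\<bar> \<le> C * norm (p - q)" if "0 < t" for t
  proof -
    have "\<bar>g (t *\<^sub>R p) / t - g (t *\<^sub>R q) / t\<bar> = \<bar>g (t *\<^sub>R p) - g (t *\<^sub>R q)\<bar> / t"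
      using that by (simp flip: diff_divide_distrib)
    also have "\<dots> \<le> (C * norm (t *\<^sub>R p - t *\<^sub>R q)) / t"
      using that g_lipschitz by (intro divide_right_mono) auto
    also have "\<dots> = C * norm (p - q)" using that by (simp flip: scaleR_diff_right)
    finally show ?thesis .
  qed
  then show "\<forall>\<^sub>F t in at_top. \<bar>g (t *\<^sub>R p) / t - g (t *\<^sub>R q) / t\<bar> \<le> C * norm (p - q)"
    by (auto simp: eventually_at_top_dense)
qed simp

text \<open>The point \<open>x + y\<close> divides the segment from \<open>x\<close> to
  \<open>x + t y\<close> in the ratio \<open>1 / t\<close>. In the convexity inequality
  \<open>g (x + t y)\<close> is replaced by \<open>g (t y)\<close> at cost
  \<open>C * norm x\<close>, which is divided by \<open>t\<close> and disappears in the
  limit.\<close>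

lemma add_le_recession: "g (x + y) \<le> g x + recession g y"
proof (rule tendsto_lowerbound)
  show "((\<lambda>t. g x + g (t *\<^sub>R y) / t + C * norm x / t) \<longlongrightarrow> g x + recession g y) at_top"
    using tendsto_add[OF tendsto_add[OF tendsto_const recession_lim] const_divide_tendsto_at_top] by simp
  have "g (x + y) \<le> g x + g (t *\<^sub>R y) / t + C * norm x / t" if t: "1 < t" for t
  proof -
    have "x + y = (1 - 1 / t) *\<^sub>R x + (1 / t) *\<^sub>R (x + t *\<^sub>R y)" using t by (simp add: algebra_simps)
    then have "g (x + y) \<le> (1 - 1 / t) * g x + (1 / t) * g (x + t *\<^sub>R y)"
      using convex_onD[OF cvx, of "1 / t" x "x + t *\<^sub>R y"] t by simp
    also have "\<dots> \<le> 1 * g x + (1 / t) * (g (t *\<^sub>R y) + C * norm x)"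
      using t g0[of x] g_lipschitz[of "x + t *\<^sub>R y" "t *\<^sub>R y"]
      by (intro add_mono mult_mono mult_left_mono) auto
    finally show ?thesis using t by (simp add: field_simps)
  qed
  then show "\<forall>\<^sub>F t in at_top. g (x + y) \<le> g x + g (t *\<^sub>R y) / t + C * norm x / t"
    by (auto simp: eventually_at_top_dense)
qed simp

text \<open>Inside the unit ball \<open>g\<close> is at most \<open>2 * C\<close> and the recession
  function at most \<open>C\<close>. Outside, the rate multiplied by \<open>t = norm p\<close> gives
  \<open>t * K / t powr \<alpha>\<close>, at most \<open>K\<close> since \<open>t \<ge> 1\<close>
  and \<open>\<alpha> > 1\<close>.\<close>

lemma recession_close: "\<bar>g p - recession g p\<bar> \<le> 3 * C + K"
proof (cases "norm p < 1")
  case True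
  have "recession g 0 = 0" using recession_hom[of 0 0] by simp
  then have "\<bar>recession g p\<bar> \<le> C * norm p" using recession_lipschitz[of p 0] by simp
  also have "\<dots> \<le> C" using True C by (simp add: mult_left_le)
  finally have 1: "\<bar>recession g p\<bar> \<le> C" .
  have "C * (1 + norm p) \<le> C * 2" using True C by (intro mult_left_mono) auto
  then have "g p \<le> C * 2" using g1[of p] by linarith
  then show ?thesis using 1 g0[of p] K C by linarith
next
  case False
  define t where "t = norm p"
  have t: "1 \<le> t" using False by (simp add: t_def)
  define e where "e = p /\<^sub>R t"
  have "t \<noteq> 0" using t by simp
  then have e: "norm e = 1" "p = t *\<^sub>R e" by (simp_all add: e_def t_def)
  have "\<bar>g p - recession g p\<bar> = \<bar>t * (g (t *\<^sub>R e) / t - recession g e)\<bar>"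
    using t e(2) recession_hom[of t e] by (simp add: right_diff_distrib)
  also have "\<dots> = t * \<bar>g (t *\<^sub>R e) / t - recession g e\<bar>" using t by (simp add: abs_mult)
  also have "\<dots> \<le> t * (K / t powr \<alpha>)" using t rec[OF e(1), of t] by (intro mult_left_mono) auto
  also have "\<dots> \<le> t * (K / t)"
  proof -
    have "t powr 1 \<le> t powr \<alpha>" using t \<alpha> by (intro powr_mono) auto
    then show ?thesis using t K by (intro mult_left_mono divide_left_mono) auto
  qed
  finally show ?thesis using t C by simp
qed

text \<open>The absolute value extends the function evenly to negative \<open>s\<close>, so that the
  Lipschitz bound holds on the whole product space, as the mollification theorem demands.\<close>

definition perspective :: "'b \<times> real \<Rightarrow> real"
  where "perspective = (\<lambda>(p, s). if s = 0 then recession g p else \<bar>s\<bar> * g (p /\<^sub>R \<bar>s\<bar>))"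

lemma perspective_0 [simp]: "perspective (p, 0) = recession g p"
  and perspective_1 [simp]: "perspective (p, 1) = g p"
  and perspective_abs: "perspective (p, \<bar>s\<bar>) = perspective (p, s)"
  by (simp_all add: perspective_def)

lemma perspective_hom:
  assumes "0 \<le> r"
  shows "perspective (r *\<^sub>R z) = r * perspective z"
proof (cases "r = 0")
  case True
  then show ?thesis using recession_hom[of 0 0] by (simp add: zero_prod_def)
next
  case False
  obtain p s where z: "z = (p, s)" by (cases z)
  have "(r *\<^sub>R p) /\<^sub>R \<bar>r * s\<bar> = p /\<^sub>R \<bar>s\<bar>"
    using False assms by (simp add: abs_mult mult.commute[of _ r] flip: mult.assoc)
  then show ?thesis
    using False assms recession_hom[OF assms, of p]
    by (simp add: z perspective_def del: scaleR_scaleR) (simp add: abs_mult)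
qed

lemma perspective_lipschitz_fst: "\<bar>perspective (p, s) - perspective (q, s)\<bar> \<le> C * norm (p - q)"
proof (cases "s = 0")
  case True
  then show ?thesis using recession_lipschitz by simp
next
  case False
  have "\<bar>perspective (p, s) - perspective (q, s)\<bar> = \<bar>s\<bar> * \<bar>g (p /\<^sub>R \<bar>s\<bar>) - g (q /\<^sub>R \<bar>s\<bar>)\<bar>"
    using False by (simp add: perspective_def abs_mult flip: right_diff_distrib)
  also have "\<dots> \<le> \<bar>s\<bar> * (C * norm (p /\<^sub>R \<bar>s\<bar> - q /\<^sub>R \<bar>s\<bar>))"
    by (intro mult_left_mono g_lipschitz) auto
  also have "\<dots> = C * norm (p - q)" using False by (simp flip: scaleR_diff_right)
  finally show ?thesis .
qed

text \<open>For \<open>a = 0\<close> the difference is \<open>b\<close> times the gap bounded in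
  \<open>recession_close\<close>. For \<open>0 < a\<close> the two one-sided bounds come from
  convexity between 0 and \<open>p / a\<close>, and from \<open>add_le_recession\<close> on the ray
  through \<open>p\<close>.\<close>

lemma perspective_lipschitz_snd_aux:
  assumes "0 \<le> a" "a < b"
  shows "\<bar>perspective (p, a) - perspective (p, b)\<bar> \<le> (3 * C + K) * (b - a)"
proof (cases "a = 0")
  case True
  have "\<bar>perspective (p, a) - perspective (p, b)\<bar> = \<bar>b * (recession g (p /\<^sub>R b) - g (p /\<^sub>R b))\<bar>"
    using assms True recession_hom[of b "p /\<^sub>R b"] by (simp add: perspective_def right_diff_distrib)
  also have "\<dots> = b * \<bar>recession g (p /\<^sub>R b) - g (p /\<^sub>R b)\<bar>" using assms by (simp add: abs_mult)
  also have "\<dots> \<le> b * (3 * C + K)"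
    using assms recession_close[of "p /\<^sub>R b"] by (intro mult_left_mono) (auto simp: abs_minus_commute)
  finally show ?thesis using True by (simp add: mult.commute)
next
  case False
  then have ab: "0 < a" "0 < b" "a < b" using assms by auto
  have P: "perspective (p, a) = a * g (p /\<^sub>R a)" "perspective (p, b) = b * g (p /\<^sub>R b)"
    using ab by (simp_all add: perspective_def)
  \<comment> \<open>Convexity towards the origin: the excess is \<open>(b - a) * g 0\<close>, and
    \<open>g 0 \<le> C\<close>.\<close>
  have eq: "p /\<^sub>R b = (1 - a / b) *\<^sub>R 0 + (a / b) *\<^sub>R (p /\<^sub>R a)" using ab by (simp add: divide_inverse)
  have "g (p /\<^sub>R b) \<le> (1 - a / b) * g 0 + (a / b) * g (p /\<^sub>R a)"
    unfolding eq using ab by (intro convex_onD[OF cvx]) auto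
  then have "b * g (p /\<^sub>R b) \<le> b * ((1 - a / b) * g 0 + (a / b) * g (p /\<^sub>R a))"
    using ab by (intro mult_left_mono) auto
  also have "\<dots> = (b - a) * g 0 + a * g (p /\<^sub>R a)" using ab by (simp add: field_simps)
  also have "(b - a) * g 0 \<le> (b - a) * (3 * C + K)"
    using g1[of 0] ab K C by (intro mult_left_mono) auto
  finally have 1: "perspective (p, b) - perspective (p, a) \<le> (3 * C + K) * (b - a)"
    by (simp add: P mult.commute)
  \<comment> \<open>Going outwards along the ray costs \<open>(b - a)\<close> times the recession
    function at \<open>p / b\<close>, which is traded for \<open>g\<close> there by
    \<open>recession_close\<close>.\<close>
  have "p /\<^sub>R a = p /\<^sub>R b + ((b - a) / a) *\<^sub>R (p /\<^sub>R b)"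
    using ab by (simp add: field_simps flip: scaleR_add_left)
  then have "g (p /\<^sub>R a) \<le> g (p /\<^sub>R b) + (b - a) / a * recession g (p /\<^sub>R b)"
    using add_le_recession[of "p /\<^sub>R b" "((b - a) / a) *\<^sub>R (p /\<^sub>R b)"] ab by (simp add: recession_hom)
  then have "a * g (p /\<^sub>R a) \<le> a * (g (p /\<^sub>R b) + (b - a) / a * recession g (p /\<^sub>R b))"
    using ab by (intro mult_left_mono) auto
  also have "\<dots> = a * g (p /\<^sub>R b) + (b - a) * recession g (p /\<^sub>R b)"
    using ab by (simp add: distrib_left)
  also have "\<dots> \<le> a * g (p /\<^sub>R b) + (b - a) * (g (p /\<^sub>R b) + (3 * C + K))"
    using recession_close[of "p /\<^sub>R b"] ab by (intro add_left_mono mult_left_mono) auto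
  finally have "perspective (p, a) - perspective (p, b) \<le> (3 * C + K) * (b - a)"
    unfolding P by (simp add: algebra_simps)
  with 1 show ?thesis by linarith
qed

lemma perspective_lipschitz_snd:
  "\<bar>perspective (p, s) - perspective (p, s')\<bar> \<le> (3 * C + K) * \<bar>s - s'\<bar>"
proof -
  have "\<bar>perspective (p, \<bar>s\<bar>) - perspective (p, \<bar>s'\<bar>)\<bar> \<le> (3 * C + K) * \<bar>\<bar>s\<bar> - \<bar>s'\<bar>\<bar>"
    using perspective_lipschitz_snd_aux[of "\<bar>s\<bar>" "\<bar>s'\<bar>" p] perspective_lipschitz_snd_aux[of "\<bar>s'\<bar>" "\<bar>s\<bar>" p]
    by (cases "\<bar>s\<bar>" "\<bar>s'\<bar>" rule: linorder_cases) (auto simp: abs_minus_commute)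
  also have "\<dots> \<le> (3 * C + K) * \<bar>s - s'\<bar>" using C K by (intro mult_left_mono) auto
  finally show ?thesis by (simp add: perspective_abs)
qed

lemma perspective_lipschitz: "\<bar>perspective z - perspective w\<bar> \<le> (4 * C + K) * norm (z - w)"
proof -
  obtain p s q s' where zw: "z = (p, s)" "w = (q, s')" by (cases z; cases w)
  have "C * norm (p - q) \<le> C * norm (z - w)"
    using norm_fst_le[of "p - q" "s - s'"] C by (intro mult_left_mono) (auto simp: zw)
  moreover have "(3 * C + K) * \<bar>s - s'\<bar> \<le> (3 * C + K) * norm (z - w)"
    using norm_snd_le[of "s - s'" "p - q"] C K by (intro mult_left_mono) (auto simp: zw)
  ultimately show ?thesis
    using perspective_lipschitz_fst[of p s q] perspective_lipschitz_snd[of q s s']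
    by (simp add: zw[symmetric] algebra_simps)
qed

end

section \<open>Convergence of the mollified energies\<close>

text \<open>Applied with \<open>A\<close> the interior and \<open>Z\<close> the frontier of
  \<open>B = \<Omega>\<close>. Neither \<open>B\<close> nor \<open>F\<close> is assumed measurable:
  off the null set \<open>Z\<close> the integrand coincides with a measurable one, and completeness
  takes care of the rest.\<close>

lemma set_integral_completion_eq:
  fixes F F' :: "'a \<Rightarrow> real"
  assumes Z: "Z \<in> null_sets M" and "A \<in> sets M" "A \<subseteq> B" "B \<subseteq> A \<union> Z"
    and F': "(\<lambda>x. indicator A x *\<^sub>R F' x) \<in> borel_measurable M" and eq: "\<And>x. x \<in> A \<Longrightarrow> F x = F' x"
  shows "(LINT x:B|completion M. F x) = (LINT x:A|M. F' x)"
proof -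
  define f where "f x = indicator B x *\<^sub>R F x" for x
  define f' where "f' x = indicator A x *\<^sub>R F' x" for x
  have ff: "f x = f' x" if "x \<notin> Z" for x
    using that assms(3,4) eq[of x] by (auto simp: f_def f'_def indicator_def)
  have f' [measurable]: "f' \<in> borel_measurable M" using F' by (simp add: f'_def[abs_def])
  then have f'c: "f' \<in> borel_measurable (completion M)" by (rule measurable_completion)
  have Zc: "Z \<in> null_sets (completion M)" using Z by (rule null_sets_completionI)
  have fc: "f \<in> borel_measurable (completion M)"
  proof (rule measurableI)
    fix S :: "real set" assume S: "S \<in> sets borel"
    have "f -` S \<inter> space M = (f' -` S \<inter> space M - Z) \<union> (f -` S \<inter> space M \<inter> Z)" using ff by auto
    moreover have "f' -` S \<inter> space M - Z \<in> sets (completion M)"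
      using measurable_sets[OF f'c S] Zc by auto
    moreover have "f -` S \<inter> space M \<inter> Z \<in> null_sets (completion M)"
      using Zc by (rule completion.complete2[rotated]) auto
    ultimately show "f -` S \<inter> space (completion M) \<in> sets (completion M)"
      by (metis sets.Un null_setsD2 space_completion)
  qed simp
  have "AE x in completion M. x \<notin> Z" using Zc by (rule AE_not_in)
  then have "integral\<^sup>L (completion M) f = integral\<^sup>L (completion M) f'"
    by (intro integral_cong_AE fc f'c) (auto elim!: eventually_mono intro: ff)
  also have "\<dots> = integral\<^sup>L M f'" by (rule integral_completion[OF f'])
  finally show ?thesis by (simp add: set_lebesgue_integral_def f_def[abs_def] f'_def[abs_def])
qed

text \<open>Both summands are the sum with indicator densities, and the two indicators add up to
  1.\<close>

lemma integral_measure_plus_singular: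
  fixes F :: "'a \<Rightarrow> 'c::euclidean_space"
  assumes NM: "sets N = sets M" and S: "S \<in> sets M" and z: "emeasure M S = 0" "emeasure N (space N - S) = 0"
    and F: "integrable M F" "integrable N F"
  shows "integrable (measure_plus M N) F"
    and "(LINT x|measure_plus M N. F x) = (LINT x|M. F x) + (LINT x|N. F x)"
proof -
  let ?P = "measure_plus M N"
  have [measurable]: "F \<in> borel_measurable ?P" using F(1) by (simp cong: measurable_cong_sets)
  have [measurable]: "S \<in> sets ?P" using S by simp
  have d: "density ?P (\<lambda>x. ennreal (indicator (space M - S) x)) = M" "density ?P (\<lambda>x. ennreal (indicator S x)) = N"
    using density_measure_plus_singular[OF NM S z] by (simp_all add: ennreal_indicator)
  have i1: "integrable ?P (\<lambda>x. indicator (space M - S) x *\<^sub>R F x)"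
    "(LINT x|M. F x) = (LINT x|?P. indicator (space M - S) x *\<^sub>R F x)"
    using F(1) integrable_density[of F ?P "indicator (space M - S)"] integral_density[of F ?P "indicator (space M - S)"]
    by (simp_all add: d)
  have i2: "integrable ?P (\<lambda>x. indicator S x *\<^sub>R F x)"
    "(LINT x|N. F x) = (LINT x|?P. indicator S x *\<^sub>R F x)"
    using F(2) integrable_density[of F ?P "indicator S"] integral_density[of F ?P "indicator S"]
    by (simp_all add: d)
  have eq: "indicator (space M - S) x *\<^sub>R F x + indicator S x *\<^sub>R F x = F x" if "x \<in> space ?P" for x
    using that by (auto simp: indicator_def)
  show "integrable ?P F"
    using Bochner_Integration.integrable_add[OF i1(1) i2(1)] eq
    by (subst (asm) Bochner_Integration.integrable_cong[OF refl eq]) auto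
  show "(LINT x|?P. F x) = (LINT x|M. F x) + (LINT x|N. F x)"
    unfolding i1(2) i2(2) Bochner_Integration.integral_add[OF i1(1) i2(1), symmetric]
    by (intro Bochner_Integration.integral_cong refl eq[symmetric])
qed

lemma mollifier_kernel_imp_bump:
  assumes "mollifier_kernel \<phi>"
  shows "bump \<phi>"
proof
  have "C_k 0 \<phi>" using assms unfolding mollifier_kernel_def by blast
  then show "continuous_on UNIV \<phi>" by simp
  show "0 \<le> \<phi> x" for x using assms unfolding mollifier_kernel_def by blast
  show "(LINT x|lborel. \<phi> x) = 1" using assms unfolding mollifier_kernel_def by blast
  show "\<phi> x = 0" if "1 \<le> norm x" for x
  proof (rule ccontr)
    assume "\<phi> x \<noteq> 0"
    then have "x \<in> closure {x. \<phi> x \<noteq> 0}"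
      using closure_subset[of "{x. \<phi> x \<noteq> 0}"] by auto
    moreover have "closure {x. \<phi> x \<noteq> 0} \<subseteq> ball 0 1"
      using assms unfolding mollifier_kernel_def by (elim conjE)
    ultimately have "x \<in> ball 0 1" by blast
    with that show False by simp
  qed
qed

theorem theorem3p4:
  fixes U \<Omega> :: "'a::euclidean_space set"
    and \<mu> :: "'a set \<Rightarrow> 'b::euclidean_space"
    and g :: "'b \<Rightarrow> real"
    and \<phi> :: "'a \<Rightarrow> real"
  assumes "mollifier_kernel \<phi>"
    and "open U" "bounded U"
    and "finite_radon_measure U \<mu>"
    and "convex_on UNIV g"
    and "\<exists>C>0. \<forall>p. 0 \<le> g p \<and> g p \<le> C * (1 + norm p)"
    and "\<exists>\<alpha>>1. \<exists>C>0. \<forall>p. norm p = 1 \<longrightarrow>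
           (\<forall>t>0. \<bar>g (t *\<^sub>R p) / t - recession g p\<bar> \<le> C / t powr \<alpha>)"
    and "compact (closure \<Omega>)" "closure \<Omega> \<subseteq> U"
    and "emeasure lborel (frontier \<Omega>) = 0"
    and "emeasure (total_variation U \<mu>) (frontier \<Omega>) = 0"
  shows "((\<lambda>\<epsilon>. LINT x:\<Omega>|lebesgue. g (mollify U \<mu> \<phi> \<epsilon> x)) \<longlongrightarrow>
           (LINT x:\<Omega>|lebesgue. g (ac_part U \<mu> x)) +
           (LINT x:\<Omega>|completion (total_variation U (sing_part U \<mu>)).
              recession g (polar_density U (sing_part U \<mu>) x))) (at_right 0)"
proof -
  note \<mu> = assms(4) and ac = ac_part_props[OF assms(2,3,4)]
  interpret bump \<phi> using assms(1) by (rule mollifier_kernel_imp_bump)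
  obtain C where C: "0 < C" "\<And>p. 0 \<le> g p" "\<And>p. g p \<le> C * (1 + norm p)" using assms(6) by blast
  obtain \<alpha> K where K: "1 < \<alpha>" "0 < K" "\<And>p t. norm p = 1 \<Longrightarrow> 0 < t \<Longrightarrow> \<bar>g (t *\<^sub>R p) / t - recession g p\<bar> \<le> K / t powr \<alpha>"
    using assms(7) by blast
  interpret recession_integrand g C K \<alpha> by standard (use assms(5) C K in auto)

  \<comment> \<open>Decomposition of the measure on \<open>U\<close>\<close>
  define f where "f = ac_part U \<mu>"
  define \<sigma> where "\<sigma> = total_variation U (sing_part U \<mu>)"
  define \<nu> where "\<nu> = polar_density U (sing_part U \<mu>)"
  define L :: "'a measure" where "L = restrict_space lborel U"
  let ?S = "sets (restrict_space borel U)"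
  have U [measurable]: "U \<in> sets borel" using assms(2) by simp
  have sL [measurable_cong]: "sets L = ?S" unfolding L_def by (rule sets_restrict_space_cong) simp
  have s\<sigma> [measurable_cong]: "sets \<sigma> = ?S" unfolding \<sigma>_def by (rule sets_total_variation[OF ac(2)])
  have spL: "space L = U" by (simp add: L_def space_restrict_space)
  have sp\<sigma>: "space \<sigma> = U" unfolding \<sigma>_def by (rule space_total_variation[OF ac(2)])
  have SB: "E \<in> sets borel" "E \<subseteq> U" if "E \<in> ?S" for E
    using that U by (auto simp: sets_restrict_space)
  have SI: "E \<in> ?S" if "E \<in> sets borel" "E \<subseteq> U" for E
    using that U by (auto simp: sets_restrict_space)
  have eL: "emeasure L E = emeasure lborel E" if "E \<in> ?S" for E
    unfolding L_def using SB[OF that] U by (intro emeasure_restrict_space) auto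
  have f\<sigma>: "finite_measure \<sigma>" unfolding \<sigma>_def by (rule finite_measure_total_variation[OF ac(2)])
  have fL: "finite_measure L"
    by (rule finite_measureI)
       (use emeasure_bounded_finite[OF assms(3)] eL[OF SI[OF U]] spL in simp)
  have if_L: "integrable L f"
    using ac(1) U unfolding L_def f_def set_integrable_def by (subst integrable_restrict_space) auto
  have i\<nu>: "integrable \<sigma> \<nu>" unfolding \<sigma>_def \<nu>_def by (rule integrable_polar_density[OF ac(2)])
  have setL: "(LINT x:E|lborel. F x) = (LINT x:E|L. F x)" if E: "E \<in> ?S" for E and F :: "'a \<Rightarrow> 'd::euclidean_space"
    unfolding set_lebesgue_integral_def L_def using U SB[OF E]
    by (subst integral_restrict_space) (auto intro!: Bochner_Integration.integral_cong simp: indicator_def)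
  have decomp: "\<mu> E = (LINT x:E|L. f x) + (LINT x:E|\<sigma>. \<nu> x)" if E: "E \<in> ?S" for E
    using polar_density_eq[OF ac(2) E] setL[OF E, of f]
    by (simp add: sing_part_def minus_density_def f_def \<sigma>_def \<nu>_def algebra_simps)

  \<comment> \<open>The carrier of the singular part\<close>
  obtain S where S: "S \<in> ?S" "emeasure lborel S = 0" "emeasure \<sigma> (U - S) = 0"
    using ac(3)[folded \<sigma>_def] unfolding lebesgue_singular_def by (elim bexE conjE) (rule that)
  note SU = SB[OF S(1)]
  have [measurable]: "S \<in> sets borel" by (rule SU)
  have LS: "emeasure L S = 0" "emeasure \<sigma> (space \<sigma> - S) = 0" "S \<in> sets L" "sets \<sigma> = sets L"
    using S eL[OF S(1)] by (simp_all add: sp\<sigma> sL s\<sigma>)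
  have AEL: "AE x in L. x \<in> U \<and> x \<notin> S"
    using AE_not_in[of S L] AE_space[of L] LS(1,3) by (auto simp: null_sets_def spL)
  have AE\<sigma>: "AE x in \<sigma>. x \<in> S"
  proof -
    have "U - S \<in> null_sets \<sigma>" using S(3) SI[of "U - S"] by (auto simp: null_sets_def s\<sigma>)
    from AE_not_in[OF this] AE_space[of \<sigma>] show ?thesis by eventually_elim (auto simp: sp\<sigma>)
  qed

  \<comment> \<open>The reference measure \<open>\<lambda>\<close>\<close>
  define P where "P = measure_plus L \<sigma>"
  \<comment> \<open>Push-forward under the inclusion of \<open>U\<close>: the same measure on the
    Borel sets of the whole space, with no mass outside \<open>U\<close>.\<close>
  define M where "M = distr P borel (\<lambda>x. x)"
  have sP [measurable_cong]: "sets P = ?S" by (simp add: P_def sL)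
  have spP: "space P = U" by (simp add: P_def spL)
  have id [measurable]: "(\<lambda>x. x) \<in> P \<rightarrow>\<^sub>M borel"
    by (rule measurableI) (auto simp: spP sP intro!: SI)
  have "finite_measure P" unfolding P_def using LS(4) fL f\<sigma> by (rule finite_measure_plus)
  then have fM: "finite_measure M" unfolding M_def by (rule finite_measure.finite_measure_distr) (rule id)
  interpret bump_measure \<phi> M
    by (intro bump_measure.intro bump_axioms fM bump_measure_axioms.intro) (simp add: M_def)
  have intM: "integrable M F" "(LINT x|M. F x) = (LINT x|L. F x) + (LINT x|\<sigma>. F x)"
    if [measurable]: "F \<in> borel_measurable borel" and F: "integrable L F" "integrable \<sigma> F" for F :: "'a \<Rightarrow> 'd::euclidean_space"
    using integral_measure_plus_singular[OF LS(4,3,1,2) F]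
    unfolding M_def by (simp_all add: integrable_distr_eq integral_distr P_def[symmetric])

  \<comment> \<open>The density of the pair with respect to \<open>\<lambda>\<close>\<close>
  define f' where "f' x = indicator U x *\<^sub>R f x" for x
  define \<nu>' where "\<nu>' x = indicator U x *\<^sub>R \<nu> x" for x
  \<comment> \<open>The second component is the density of Lebesgue measure: 0 on the carrier of the
    singular part, 1 on the rest of \<open>U\<close>. The zero extensions \<open>f'\<close> and
    \<open>\<nu>'\<close> make \<open>w\<close> Borel on the whole space.\<close>
  define w where "w x = indicator S x *\<^sub>R (\<nu>' x, 0::real) + indicator (U - S) x *\<^sub>R (f' x, 1::real)" for x
  have [measurable]: "f' \<in> borel_measurable borel"
    using borel_measurable_integrable[OF ac(1)[unfolded set_integrable_def]] by (simp add: f'_def[abs_def] f_def)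
  have [measurable]: "\<nu>' \<in> borel_measurable borel"
    using borel_measurable_integrable[OF i\<nu>] borel_measurable_restrict_space_iff[of U borel \<nu>] U
    by (simp add: \<nu>'_def[abs_def] measurable_cong_sets[OF s\<sigma> refl])
  have wm [measurable]: "w \<in> borel_measurable borel" unfolding w_def by measurable
  have wfst [measurable]: "(\<lambda>x. fst (w x)) \<in> borel_measurable borel"
      and wsnd [measurable]: "(\<lambda>x. snd (w x)) \<in> borel_measurable borel"
    using measurable_compose[OF wm borel_measurable_continuous_onI[OF continuous_on_fst[OF continuous_on_id]]]
      measurable_compose[OF wm borel_measurable_continuous_onI[OF continuous_on_snd[OF continuous_on_id]]]
    by auto
  have wL: "AE x in L. w x = (f x, 1)"
    using AEL by eventually_elim (auto simp: w_def f'_def indicator_def zero_prod_def)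
  have w\<sigma>: "AE x in \<sigma>. w x = (\<nu> x, 0)"
    using AE\<sigma> SU(2) by (auto elim!: eventually_mono simp: w_def \<nu>'_def indicator_def zero_prod_def)
  have idL [measurable]: "(\<lambda>x. x) \<in> L \<rightarrow>\<^sub>M borel" and id\<sigma> [measurable]: "(\<lambda>x. x) \<in> \<sigma> \<rightarrow>\<^sub>M borel"
    by (rule measurableI; auto simp: spL sL sp\<sigma> s\<sigma> intro!: SI)+
  have wmL: "w \<in> borel_measurable L" and wm\<sigma>: "w \<in> borel_measurable \<sigma>"
    using measurable_compose[OF idL wm] measurable_compose[OF id\<sigma> wm] by simp_all
  have [measurable]: "f \<in> borel_measurable L" and [measurable]: "\<nu> \<in> borel_measurable \<sigma>"
    using if_L i\<nu> by auto
  have pair0: "bounded_linear (\<lambda>v::'b. (v, 0::real))"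
    by (intro bounded_linear_Pair bounded_linear_ident bounded_linear_zero)
  have iwL: "integrable L w"
  proof (subst integrable_cong_AE[OF wmL _ wL])
    have "integrable L (\<lambda>x. (f x, 0) + (0, 1::real))"
      by (intro Bochner_Integration.integrable_add finite_measure.integrable_const[OF fL]
          integrable_bounded_linear[OF pair0 if_L])
    then show "integrable L (\<lambda>x. (f x, 1::real))" by simp
  qed auto
  have iw\<sigma>: "integrable \<sigma> w"
    by (subst integrable_cong_AE[OF wm\<sigma> _ w\<sigma>]) (use integrable_bounded_linear[OF pair0 i\<nu>] in auto)
  note iw = intM(1)[OF wm iwL iw\<sigma>]

  \<comment> \<open>Reduction from \<open>\<Omega>\<close> to its interior\<close>
  define A where "A = interior \<Omega>"
  define Z where "Z = frontier \<Omega>"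
  have A [measurable]: "A \<in> sets borel" by (simp add: A_def)
  have Z [measurable]: "Z \<in> sets borel" by (simp add: Z_def)
  have "Z \<subseteq> U" "A \<subseteq> U"
    using assms(9) interior_subset[of \<Omega>] closure_subset[of \<Omega>] by (auto simp: Z_def A_def frontier_def)
  note AS = SI[OF A \<open>A \<subseteq> U\<close>] and ZS = SI[OF Z \<open>Z \<subseteq> U\<close>]
  have A\<Omega>: "A \<subseteq> \<Omega>" "\<Omega> \<subseteq> A \<union> Z"
    using interior_subset[of \<Omega>] closure_subset[of \<Omega>] by (auto simp: Z_def A_def frontier_def)
  \<comment> \<open>The hypothesis concerns the variation of \<open>\<mu>\<close>, not of its
    singular part. On each Borel subset of the frontier both \<open>\<mu>\<close> and the integral
    of \<open>f\<close> vanish, hence so does their difference.\<close>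
  have \<sigma>Z: "emeasure \<sigma> Z = 0"
    unfolding \<sigma>_def emeasure_total_variation[OF ac(2) ZS]
  proof (rule variation_eq_0)
    fix E assume E: "E \<in> ?S" "E \<subseteq> Z"
    have "emeasure (total_variation U \<mu>) E \<le> emeasure (total_variation U \<mu>) Z"
      using E ZS \<mu> by (intro emeasure_mono) auto
    then have "measure (total_variation U \<mu>) E = 0" using assms(11) by (simp add: Z_def measure_def)
    then have "\<mu> E = 0" using norm_le_total_variation[OF \<mu> E(1)] by simp
    moreover have "emeasure lborel E \<le> emeasure lborel Z" using E by (intro emeasure_mono) auto
    then have "E \<in> null_sets lborel" using SB[OF E(1)] assms(10) by (auto simp: Z_def null_sets_def)
    from AE_not_in[OF this] have "AE x in lborel. indicator E x *\<^sub>R f x = 0"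
      by eventually_elim simp
    then have "(LINT x:E|lborel. f x) = 0"
      unfolding set_lebesgue_integral_def by (rule integral_eq_zero_AE)
    ultimately show "sing_part U \<mu> E = 0" by (simp add: sing_part_def minus_density_def f_def)
  qed
  have "emeasure M (frontier A) \<le> emeasure M Z"
    using Z by (intro emeasure_mono) (auto simp: M_def A_def Z_def frontier_interior_subset)
  also have "emeasure M Z = emeasure P Z"
    unfolding M_def using \<open>Z \<subseteq> U\<close> by (simp add: emeasure_distr[OF id Z] spP Int_absorb2)
  also have "\<dots> = emeasure L Z + emeasure \<sigma> Z"
    unfolding P_def using ZS by (intro emeasure_measure_plus LS) (simp add: sL)
  also have "\<dots> = 0" using \<sigma>Z eL[OF ZS] assms(10) by (simp add: Z_def)
  finally have MA: "emeasure M (frontier A) = 0" by simp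

  \<comment> \<open>The limit and its value\<close>
  have persp_m [measurable]: "perspective \<in> borel_measurable borel"
    by (rule lipschitz_nonneg_measurable(2)[OF perspective_lipschitz])
  have "perspective 0 = 0" using perspective_hom[of 0 0] by simp
  note ipersp = integrable_lipschitz_comp[OF _ perspective_lipschitz this]
  have lim: "((\<lambda>\<epsilon>. LINT x:A|lborel. perspective (conv w \<epsilon> x)) \<longlongrightarrow> (LINT x:A|M. perspective (w x))) (at_right 0)"
    by (rule reshetnyak_mollification[OF iw A MA perspective_lipschitz perspective_hom])

  have [measurable]: "g \<in> borel_measurable borel"
    by (rule lipschitz_nonneg_measurable(2)[OF g_lipschitz])
  have [measurable]: "recession g \<in> borel_measurable borel"
    by (rule lipschitz_nonneg_measurable(2)[OF recession_lipschitz])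
  have Zlb: "Z \<in> null_sets lborel" using assms(10) by (auto simp: Z_def null_sets_def)
  have Z\<sigma>n: "Z \<in> null_sets \<sigma>" using \<sigma>Z ZS by (auto simp: null_sets_def s\<sigma>)

  have "(LINT x:A|M. perspective (w x)) = (LINT x:A|L. perspective (w x)) + (LINT x:A|\<sigma>. perspective (w x))"
    unfolding set_lebesgue_integral_def
    by (intro intM(2) integrable_mult_indicator ipersp iwL iw\<sigma>) (use AS in \<open>auto simp: sL s\<sigma>\<close>)
  also have "(LINT x:A|L. perspective (w x)) = (LINT x:A|L. g (f x))"
    unfolding set_lebesgue_integral_def
    using wL AS wmL by (intro integral_cong_AE) (auto elim!: eventually_mono simp: sL)
  also have "\<dots> = (LINT x:A|lborel. g (f x))" by (rule setL[OF AS, symmetric])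
  also have "\<dots> = (LINT x:\<Omega>|lebesgue. g (f x))"
  proof (rule set_integral_completion_eq[OF Zlb _ A\<Omega>, symmetric])
    \<comment> \<open>Only the zero extension \<open>f'\<close> is known to be Borel; inside
      \<open>A\<close> it agrees with \<open>f\<close>.\<close>
    have "(\<lambda>x. indicator A x *\<^sub>R g (f x)) = (\<lambda>x. indicator A x *\<^sub>R g (f' x))"
      using \<open>A \<subseteq> U\<close> by (auto simp: f'_def indicator_def fun_eq_iff)
    then show "(\<lambda>x. indicator A x *\<^sub>R g (f x)) \<in> borel_measurable lborel" by simp
  qed auto
  also have "(LINT x:A|\<sigma>. perspective (w x)) = (LINT x:A|\<sigma>. recession g (\<nu> x))"
    unfolding set_lebesgue_integral_def
    using w\<sigma> AS wm\<sigma> by (intro integral_cong_AE) (auto elim!: eventually_mono simp: s\<sigma>)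
  also have "\<dots> = (LINT x:\<Omega>|completion \<sigma>. recession g (\<nu> x))"
    by (rule set_integral_completion_eq[OF Z\<sigma>n _ A\<Omega>, symmetric]) (use AS in \<open>auto simp: s\<sigma>\<close>)
  finally have rhs: "(LINT x:A|M. perspective (w x)) =
      (LINT x:\<Omega>|lebesgue. g (f x)) + (LINT x:\<Omega>|completion \<sigma>. recession g (\<nu> x))" .

  \<comment> \<open>Components of the mollified pair\<close>
  have fst_conv: "fst (conv w \<epsilon> x) = mollify U \<mu> \<phi> \<epsilon> x" if \<epsilon>: "0 < \<epsilon>" for \<epsilon> x
  proof -
    define k where "k y = rescale \<phi> \<epsilon> (x - y)" for y
    have km [measurable]: "k \<in> borel_measurable borel" unfolding k_def by measurable
    obtain B where B: "\<And>y. rescale \<phi> \<epsilon> y \<le> B" using rescale_bounded[OF \<epsilon>] by blast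
    have k0: "0 \<le> k y" "\<bar>k y\<bar> \<le> B" for y
      using rescale_nonneg[OF \<epsilon>, of "x - y"] B[of "x - y"] by (simp_all add: k_def)
    have kL: "k \<in> borel_measurable L" and k\<sigma>: "k \<in> borel_measurable \<sigma>"
      using measurable_compose[OF idL km] measurable_compose[OF id\<sigma> km] by simp_all
    have ikL: "integrable L (\<lambda>y. k y *\<^sub>R fst (w y))" and ik\<sigma>: "integrable \<sigma> (\<lambda>y. k y *\<^sub>R fst (w y))"
      using integrable_bounded_scaleR[OF integrable_fst[OF iwL] kL k0(2)]
        integrable_bounded_scaleR[OF integrable_fst[OF iw\<sigma>] k\<sigma> k0(2)] by simp_all
    have "fst (conv w \<epsilon> x) = (LINT y|M. fst (k y *\<^sub>R w y))"
      unfolding conv_def k_def[symmetric] using integrable_conv[OF \<epsilon> iw, of x]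
      by (intro integral_fst[symmetric]) (simp add: k_def)
    also have "\<dots> = (LINT y|L. k y *\<^sub>R fst (w y)) + (LINT y|\<sigma>. k y *\<^sub>R fst (w y))"
      using intM(2)[OF borel_measurable_scaleR[OF km wfst] ikL ik\<sigma>] by simp
    also have "(LINT y|L. k y *\<^sub>R fst (w y)) = (LINT y|L. k y *\<^sub>R f y)"
      using wL wmL kL by (intro integral_cong_AE) (auto elim!: eventually_mono)
    also have "(LINT y|\<sigma>. k y *\<^sub>R fst (w y)) = (LINT y|\<sigma>. k y *\<^sub>R \<nu> y)"
      using w\<sigma> wm\<sigma> k\<sigma> by (intro integral_cong_AE) (auto elim!: eventually_mono)
    \<comment> \<open>The polar density of \<open>\<mu>\<close> and the pair \<open>f\<close>,
      \<open>\<nu>\<close> refer to different base measures, so they are compared through the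
      set-function identity \<open>decomp\<close>, tested against the kernel.\<close>
    also have "(LINT y|L. k y *\<^sub>R f y) + (LINT y|\<sigma>. k y *\<^sub>R \<nu> y)
        = (LINT y|total_variation U \<mu>. k y *\<^sub>R polar_density U \<mu> y)"
    proof (rule integral_scaleR_eq_if_set_integral_eq[symmetric])
      have s: "sets (total_variation U \<mu>) = ?S" by (rule sets_total_variation[OF \<mu>])
      show "sets L = sets (total_variation U \<mu>)" "sets \<sigma> = sets (total_variation U \<mu>)" by (simp_all add: s sL s\<sigma>)
      show "integrable (total_variation U \<mu>) (polar_density U \<mu>)" by (rule integrable_polar_density[OF \<mu>])
      show "integrable L f" "integrable \<sigma> \<nu>" by fact+
      show "(LINT x:E|total_variation U \<mu>. polar_density U \<mu> x) = (LINT x:E|L. f x) + (LINT x:E|\<sigma>. \<nu> x)"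
        if "E \<in> sets (total_variation U \<mu>)" for E
        using polar_density_eq[OF \<mu>, of E] decomp[of E] that by (simp add: s)
      show "k \<in> borel_measurable (total_variation U \<mu>)"
        using kL by (simp add: measurable_cong_sets[OF s refl] measurable_cong_sets[OF sL refl])
      show "\<exists>B. \<forall>y\<in>space (total_variation U \<mu>). k y \<le> B" using k0 by (meson abs_le_D1)
    qed (rule k0)
    finally show ?thesis by (simp add: mollify_def vec_integral_def k_def)
  qed

  \<comment> \<open>If the ball leaves \<open>U\<close>, part of the kernel mass may be lost; inside
    \<open>U\<close> all of it is integrated.\<close>
  have snd_conv: "snd (conv w \<epsilon> x) = 1" if \<epsilon>: "0 < \<epsilon>" "ball x \<epsilon> \<subseteq> U" for \<epsilon> x
  proof -
    define k where "k y = rescale \<phi> \<epsilon> (x - y)" for y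
    have km [measurable]: "k \<in> borel_measurable borel" unfolding k_def by measurable
    obtain B where B: "\<And>y. rescale \<phi> \<epsilon> y \<le> B" using rescale_bounded[OF \<epsilon>(1)] by blast
    have k0: "0 \<le> k y" "\<bar>k y\<bar> \<le> B" for y
      using rescale_nonneg[OF \<epsilon>(1), of "x - y"] B[of "x - y"] by (simp_all add: k_def)
    have kL: "k \<in> borel_measurable L" and k\<sigma>: "k \<in> borel_measurable \<sigma>"
      using measurable_compose[OF idL km] measurable_compose[OF id\<sigma> km] by simp_all
    have ikL: "integrable L (\<lambda>y. k y *\<^sub>R snd (w y))" and ik\<sigma>: "integrable \<sigma> (\<lambda>y. k y *\<^sub>R snd (w y))"
      using integrable_bounded_scaleR[OF integrable_snd[OF iwL] kL k0(2)]
        integrable_bounded_scaleR[OF integrable_snd[OF iw\<sigma>] k\<sigma> k0(2)] by simp_all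
    have "snd (conv w \<epsilon> x) = (LINT y|M. snd (k y *\<^sub>R w y))"
      unfolding conv_def k_def[symmetric] using integrable_conv[OF \<epsilon>(1) iw, of x]
      by (intro integral_snd[symmetric]) (simp add: k_def)
    also have "\<dots> = (LINT y|L. k y *\<^sub>R snd (w y)) + (LINT y|\<sigma>. k y *\<^sub>R snd (w y))"
      using intM(2)[OF borel_measurable_scaleR[OF km wsnd] ikL ik\<sigma>] by simp
    also have "(LINT y|L. k y *\<^sub>R snd (w y)) = (LINT y|L. k y)"
      using wL wmL kL by (intro integral_cong_AE) (auto elim!: eventually_mono)
    also have "(LINT y|\<sigma>. k y *\<^sub>R snd (w y)) = (LINT y|\<sigma>. 0)"
      using w\<sigma> wm\<sigma> k\<sigma> by (intro integral_cong_AE) (auto elim!: eventually_mono)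
    also have "(LINT y|L. k y) = (LINT y|lborel. indicator U y *\<^sub>R k y)"
      unfolding L_def using U by (intro integral_restrict_space) auto
    also have "(\<lambda>y. indicator U y *\<^sub>R k y) = (\<lambda>y. rescale \<phi> \<epsilon> (x - y))"
    proof
      fix y show "indicator U y *\<^sub>R k y = rescale \<phi> \<epsilon> (x - y)"
      proof (cases "y \<in> U")
        case False
        then have "\<epsilon> \<le> norm (x - y)" using \<epsilon>(2) by (force simp: dist_norm)
        then show ?thesis using False rescale_eq_0[OF \<epsilon>(1)] by simp
      qed (simp add: k_def)
    qed
    finally show ?thesis using integral_rescale(2)[OF \<epsilon>(1)] by simp
  qed

  \<comment> \<open>Mollification at scales below the distance from \<open>\<Omega>\<close> to the
    complement of \<open>U\<close>\<close>
  obtain d where d: "0 < d" "\<And>x. x \<in> A \<Longrightarrow> ball x d \<subseteq> U"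
  proof -
    obtain d where d: "0 < d" "\<And>x y. x \<in> closure \<Omega> \<Longrightarrow> y \<in> - U \<Longrightarrow> d \<le> dist x y"
      using separate_compact_closed[OF assms(8), of "- U"] closed_Compl[OF assms(2)] assms(9) by blast
    have "ball x d \<subseteq> U" if "x \<in> A" for x
    proof
      fix y assume "y \<in> ball x d"
      moreover have "x \<in> closure \<Omega>" using that A\<Omega>(1) closure_subset by blast
      ultimately show "y \<in> U" using d(2)[of x y] by force
    qed
    with d(1) show thesis by (rule that)
  qed
  have "(LINT x:A|lborel. perspective (conv w \<epsilon> x)) = (LINT x:\<Omega>|lebesgue. g (mollify U \<mu> \<phi> \<epsilon> x))"
    if \<epsilon>: "0 < \<epsilon>" "\<epsilon> < d" for \<epsilon>
  proof (rule set_integral_completion_eq[OF Zlb _ A\<Omega>, symmetric])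
    show "g (mollify U \<mu> \<phi> \<epsilon> x) = perspective (conv w \<epsilon> x)" if "x \<in> A" for x
    proof -
      have "ball x \<epsilon> \<subseteq> U" using d(2)[OF that] \<epsilon>(2) by (meson less_imp_le order_trans subset_ball)
      then have "conv w \<epsilon> x = (mollify U \<mu> \<phi> \<epsilon> x, 1)"
        using fst_conv[OF \<epsilon>(1)] snd_conv[OF \<epsilon>(1)] by (simp add: prod_eq_iff)
      then show ?thesis by simp
    qed
    \<comment> \<open>Measurability is known for the mollified pair cut off to \<open>A\<close>, so
      homogeneity brings the indicator inside.\<close>
    have "(\<lambda>x. indicator A x *\<^sub>R perspective (conv w \<epsilon> x)) = (\<lambda>x. perspective (indicator A x *\<^sub>R conv w \<epsilon> x))"
      by (simp add: perspective_hom)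
    then show "(\<lambda>x. indicator A x *\<^sub>R perspective (conv w \<epsilon> x)) \<in> borel_measurable lborel"
      using measurable_compose[OF borel_measurable_integrable[OF integral_conv(1)[OF \<epsilon>(1) iw A]] persp_m] by simp
  qed simp
  then have "\<forall>\<^sub>F \<epsilon> in at_right 0. (LINT x:A|lborel. perspective (conv w \<epsilon> x))
      = (LINT x:\<Omega>|lebesgue. g (mollify U \<mu> \<phi> \<epsilon> x))"
    using d(1) unfolding eventually_at_right_field by blast
  from Lim_transform_eventually[OF lim this] show ?thesis
    unfolding rhs f_def \<sigma>_def \<nu>_def .
qed

end
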